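(* For every $N\ge2$, every admissible finite correspondence $\{(x_i,y_i)\}_{i=1}^M$ in $\mathbb R^N$, and every $T>0$, there exist $p\in\{0,1,2,\ldots\}$, vectors $w_j,a_j\in\mathbb R^N$ and scalars $b_j\in\mathbb R$ ($1\le j\le p$) such that the time-independent field $$V(x)=\sum_{j=1}^p w_j\,(a_j^\top x+b_j)_+$$ has time-$T$ flow map satisfying $\Phi_V^T(x_i)=y_i$ for all $i=1,\ldots,M$. (This includes stationary constraints $x_i=y_i$, cross-relations $y_i=x_j$, finite cycles, and arbitrary overlap between the input and target configurations.)
   Context: $(s)_+:=\max\{s,0\}$; the empty sum ($p=0$) is the zero field. $M\ge1$ is an integer. A finite correspondence $\{(x_i,y_i)\}_{i=1}^M\subset\mathbb R^N\times\mathbb R^N$ is admissible if the inputs $x_i$ are pairwise distinct and the targets $y_i$ are pairwise distinct (no other condition is imposed). Fields of the displayed form are globally Lipschitz, hence generate a unique global flow $\Phi_V^t$, $t\in\mathbb R$. *)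

theory Defs
  imports "HOL-Analysis.Analysis"
begin

definition admissible :: "nat \<Rightarrow> (nat \<Rightarrow> real ^ 'n) \<Rightarrow> (nat \<Rightarrow> real ^ 'n) \<Rightarrow> bool" where
  "admissible M x y \<longleftrightarrow> inj_on x {1..M} \<and> inj_on y {1..M}"

definition pos_part :: "real \<Rightarrow> real" where
  "pos_part s = max s 0"

definition relu_field ::
  "nat \<Rightarrow> (nat \<Rightarrow> real ^ 'n) \<Rightarrow> (nat \<Rightarrow> real ^ 'n) \<Rightarrow> (nat \<Rightarrow> real) \<Rightarrow> real ^ 'n \<Rightarrow> real ^ 'n" where
  "relu_field p w a b x = (\<Sum>j=1..p. pos_part (a j \<bullet> x + b j) *\<^sub>R w j)"

(* \<Phi> t x is the position at time t, for every real t, of the trajectory that starts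
   at x at time 0.  Stated as a predicate on \<Phi>; by global_flow_unique and
   relu_field_lipschitz a field relu_field p w a b has at most one such \<Phi>. *)
definition global_flow :: "(real ^ 'n \<Rightarrow> real ^ 'n) \<Rightarrow> (real \<Rightarrow> real ^ 'n \<Rightarrow> real ^ 'n) \<Rightarrow> bool" where
  "global_flow V \<Phi> \<longleftrightarrow>
     (\<forall>x. \<Phi> 0 x = x \<and>
          (\<forall>t. ((\<lambda>s. \<Phi> s x) has_vector_derivative V (\<Phi> t x)) (at t)))"

lemma relu_field_lipschitz:
  fixes w a :: "nat \<Rightarrow> real ^ 'n"
  shows "(\<Sum>j=1..p. norm (a j) * norm (w j))-lipschitz_on UNIV (relu_field p w a b)"
proof (rule lipschitz_onI)
  show "0 \<le> (\<Sum>j=1..p. norm (a j) * norm (w j))"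
    by (intro sum_nonneg) simp
next
  fix x y :: "real ^ 'n"
  have "norm (relu_field p w a b x - relu_field p w a b y)
      = norm (\<Sum>j=1..p. (pos_part (a j \<bullet> x + b j) - pos_part (a j \<bullet> y + b j)) *\<^sub>R w j)"
    by (simp add: relu_field_def sum_subtractf scaleR_diff_left)
  also have "\<dots> \<le> (\<Sum>j=1..p. norm (a j) * norm (w j) * norm (x - y))"
  proof (rule sum_norm_le)
    fix j
    have "\<bar>pos_part (a j \<bullet> x + b j) - pos_part (a j \<bullet> y + b j)\<bar> \<le> \<bar>a j \<bullet> (x - y)\<bar>"
      by (auto simp: pos_part_def inner_diff_right max_def)
    also have "\<dots> \<le> norm (a j) * norm (x - y)"
      by (rule Cauchy_Schwarz_ineq2)
    finally have "\<bar>pos_part (a j \<bullet> x + b j) - pos_part (a j \<bullet> y + b j)\<bar> * norm (w j)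
        \<le> norm (a j) * norm (x - y) * norm (w j)"
      by (rule mult_right_mono) simp
    then show "norm ((pos_part (a j \<bullet> x + b j) - pos_part (a j \<bullet> y + b j)) *\<^sub>R w j)
        \<le> norm (a j) * norm (w j) * norm (x - y)"
      by (simp add: ac_simps)
  qed
  finally show "dist (relu_field p w a b x) (relu_field p w a b y)
      \<le> (\<Sum>j=1..p. norm (a j) * norm (w j)) * dist x y"
    by (simp add: dist_norm sum_distrib_right)
qed

lemma global_flow_unique:
  assumes V: "L-lipschitz_on UNIV V" and "global_flow V \<Phi>" "global_flow V \<Psi>"
  shows "\<Phi> = \<Psi>"
proof (intro ext)
  fix t x
  define z where "z s = \<Phi> s x - \<Psi> s x" for s
  define d where "d s = 2 * (z s \<bullet> (V (\<Phi> s x) - V (\<Psi> s x)))" for s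
  have z0: "z 0 = 0"
    using assms by (simp add: z_def global_flow_def)
  have "(z has_vector_derivative (V (\<Phi> s x) - V (\<Psi> s x))) (at s)" for s
    unfolding z_def using assms by (intro has_vector_derivative_diff) (auto simp: global_flow_def)
  then have "((\<lambda>s. z s \<bullet> z s) has_derivative
      (\<lambda>h. z s \<bullet> (h *\<^sub>R (V (\<Phi> s x) - V (\<Psi> s x))) + (h *\<^sub>R (V (\<Phi> s x) - V (\<Psi> s x))) \<bullet> z s)) (at s)" for s
    unfolding has_vector_derivative_def by (intro has_derivative_inner)
  then have dz: "((\<lambda>s. z s \<bullet> z s) has_real_derivative d s) (at s)" for s
    unfolding has_field_derivative_def
    by (rule has_derivative_eq_rhs) (auto simp: d_def inner_commute algebra_simps)
  have d: "\<bar>d s\<bar> \<le> 2 * L * (z s \<bullet> z s)" for s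
  proof -
    have "\<bar>z s \<bullet> (V (\<Phi> s x) - V (\<Psi> s x))\<bar> \<le> norm (z s) * norm (V (\<Phi> s x) - V (\<Psi> s x))"
      by (rule Cauchy_Schwarz_ineq2)
    also have "\<dots> \<le> norm (z s) * (L * norm (z s))"
      using lipschitz_onD[OF V, of "\<Phi> s x" "\<Psi> s x"]
      by (intro mult_left_mono) (auto simp: dist_norm z_def)
    finally show ?thesis
      by (simp add: d_def abs_mult dot_square_norm power2_eq_square ac_simps)
  qed
  have deriv: "((\<lambda>s. (z s \<bullet> z s) * exp (c * s)) has_real_derivative
      (d s + c * (z s \<bullet> z s)) * exp (c * s)) (at s)" for c s
    by (rule derivative_eq_intros dz refl | simp add: algebra_simps)+
  have "(z t \<bullet> z t) * exp (c * t) \<le> 0" if c: "c = (if t \<ge> 0 then - 2 * L else 2 * L)" for c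
  proof (cases "t \<ge> 0")
    case True
    have "(z t \<bullet> z t) * exp (c * t) \<le> (z 0 \<bullet> z 0) * exp (c * 0)"
    proof (rule DERIV_nonpos_imp_nonincreasing[OF True])
      fix s
      show "\<exists>y. ((\<lambda>s. (z s \<bullet> z s) * exp (c * s)) has_real_derivative y) (at s) \<and> y \<le> 0"
        using d[of s] c True
        by (intro exI[of _ "(d s + c * (z s \<bullet> z s)) * exp (c * s)"] conjI deriv)
           (auto intro!: mult_nonpos_nonneg)
    qed
    then show ?thesis by (simp add: z0)
  next
    case False
    then have "t \<le> 0" by simp
    then have "(z t \<bullet> z t) * exp (c * t) \<le> (z 0 \<bullet> z 0) * exp (c * 0)"
    proof (rule DERIV_nonneg_imp_nondecreasing)
      fix s
      show "\<exists>y. ((\<lambda>s. (z s \<bullet> z s) * exp (c * s)) has_real_derivative y) (at s) \<and> 0 \<le> y"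
        using d[of s] c False
        by (intro exI[of _ "(d s + c * (z s \<bullet> z s)) * exp (c * s)"] conjI deriv)
           (auto intro!: mult_nonneg_nonneg)
    qed
    then show ?thesis by (simp add: z0)
  qed
  then have "z t \<bullet> z t \<le> 0"
    by (simp add: mult_le_0_iff not_le)
  then have "z t = 0"
    by (metis inner_ge_zero inner_eq_zero_iff order_antisym)
  then show "\<Phi> t x = \<Psi> t x"
    by (simp add: z_def)
qed

end

theory Submission
  imports Defs "HOL-Combinatorics.Orbits" "HOL-Combinatorics.Cycles"
begin

text \<open>
  The correspondence extends to a permutation of the finite set \<open>Z\<close> of all inputs and targets. In
  a coordinate plane put each cycle of the permutation on its own circle, equally spaced; the flow
  rotating every circle rigidly at a speed that depends on the radius moves each point one step
  along its cycle in time \<open>T\<close>. A composition of shears \<open>x \<mapsto> x + F (v \<bullet> x)\<close> with \<open>F \<bottom> v\<close> carries the points on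
  the circles to \<open>Z\<close>, and conjugation yields a \<open>C\<^sup>1\<close> flow \<open>\<Phi>\<close> with field \<open>V\<close> that realises the
  permutation, such that the arcs \<open>\<Phi> [0, T] z\<close> avoid each other's midpoints.

  ReLU fields are uniformly dense on compact sets, so \<open>V\<close> plus bumps of strength \<open>\<theta> z\<close> at the
  midpoints can be approximated by ReLU fields. For a trajectory \<open>X\<close> of such a field,
  \<open>q t = \<Phi> (- t) (X t)\<close> satisfies \<open>q T - z \<approx> \<theta> z\<close>, up to an error smaller than the range of the
  parameters. Brouwer's theorem then gives parameters with \<open>q T = z\<close> for all \<open>z \<in> Z\<close>
  simultaneously, that is \<open>X T = \<Phi> T z\<close>.
\<close>

text \<open>An autonomous field cannot treat the pairs one at a time: if \<open>y i = x j\<close>,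
  the trajectory of \<open>x i\<close> continues as that of \<open>x j\<close>, and a cycle of such
  relations is a closed orbit. Hence one flow realises the whole permutation. A fixed point is not
  left at rest but makes a full turn of its own circle, so that it too has an arc whose midpoint is
  visited only once.

  Density alone brings endpoints close to the targets; exactness comes from correcting all endpoints
  at once. Bumps sit at midpoints because consecutive arcs of a cycle share endpoints, whereas a
  midpoint lies on a single arc; each parameter then acts, to first order, on a single endpoint.

  The errors must be small relative to the range \<rho> of the parameters. Those from the width of
  the bumps and from the drift of trajectories off the arcs are proportional to \<rho>, with factors
  fixed before \<rho>; the tolerance \<delta> of the approximation is fixed after it. Each gets a
  quarter of \<rho>.\<close>

section \<open>Brouwer's theorem on a cube with finitely many coordinates\<close>

text \<open>
  The number of parameters depends on \<open>M\<close>, so the library version, in which the dimension is a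
  type, does not apply; Kuhn's combinatorial lemma is available for arbitrary dimension.
\<close>

lemma approx_fixpoint_cube:
  fixes f :: "('k \<Rightarrow> real) \<Rightarrow> 'k \<Rightarrow> real"
  assumes I: "finite I" and \<rho>: "\<rho> > 0" and \<epsilon>: "\<epsilon> > 0"
    and maps: "\<And>x i. (\<forall>k\<in>I. \<bar>x k\<bar> \<le> \<rho>) \<Longrightarrow> i \<in> I \<Longrightarrow> \<bar>f x i\<bar> \<le> \<rho>"
    and uc: "\<And>\<epsilon>. \<epsilon> > 0 \<Longrightarrow> \<exists>\<delta>>0. \<forall>x y. (\<forall>k\<in>I. \<bar>x k\<bar> \<le> \<rho>) \<longrightarrow> (\<forall>k\<in>I. \<bar>y k\<bar> \<le> \<rho>) \<longrightarrow>
            (\<forall>k\<in>I. \<bar>x k - y k\<bar> < \<delta>) \<longrightarrow> (\<forall>k\<in>I. \<bar>f x k - f y k\<bar> < \<epsilon>)"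
  shows "\<exists>x. (\<forall>k\<in>I. \<bar>x k\<bar> \<le> \<rho>) \<and> (\<forall>i\<in>I. \<bar>f x i - x i\<bar> < \<epsilon>)"
proof -
  obtain \<delta> where \<delta>: "\<delta> > 0" and close: "\<And>x y i. \<lbrakk>\<forall>k\<in>I. \<bar>x k\<bar> \<le> \<rho>; \<forall>k\<in>I. \<bar>y k\<bar> \<le> \<rho>;
      \<forall>k\<in>I. \<bar>x k - y k\<bar> < \<delta>; i \<in> I\<rbrakk> \<Longrightarrow> \<bar>f x i - f y i\<bar> < \<epsilon> / 2"
    using uc[of "\<epsilon>/2"] \<epsilon> by auto
  define n where "n = card I"
  obtain b where b: "bij_betw b I {..<n}"
    using finite_same_card_bij[OF I finite_lessThan, of n] by (auto simp: n_def)
  have bI: "b k < n" if "k \<in> I" for k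
    using b that by (auto simp: bij_betw_def)
  \<comment> \<open>The mesh has two tasks: on one cell \<open>f\<close> varies by less than
    \<epsilon> / 2 and so does each coordinate; together they give \<epsilon>.\<close>
  obtain m where m: "0 < m" "m \<le> \<delta>" "m \<le> \<epsilon> / 2"
    using that[of "min \<delta> (\<epsilon> / 2)"] \<delta> \<epsilon> by simp
  obtain p :: nat where p: "2 * \<rho> / m < real p"
    using reals_Archimedean2 by blast
  have "0 < 2 * \<rho> / m" using m \<rho> by simp
  with p have p0: "real p > 0" by linarith
  then have p0': "0 < p" by simp
  have "2 * \<rho> / real p < m"
    using p m(1) p0 by (simp add: divide_less_eq mult.commute)
  then have mesh: "2 * \<rho> / real p < \<delta>" "2 * \<rho> / real p < \<epsilon> / 2"
    using m by linarith+
  define X where "X q k = \<rho> * (2 * real (q (b k)) / real p - 1)" for q k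
  have Xcube: "\<bar>X q k\<bar> \<le> \<rho>" if "\<forall>i<n. q i \<le> p" "k \<in> I" for q k
  proof -
    have "0 \<le> real (q (b k)) / real p" "real (q (b k)) / real p \<le> 1"
      using that bI p0 by auto
    then have "\<bar>2 * (real (q (b k)) / real p) - 1\<bar> \<le> 1" by linarith
    then have "\<rho> * \<bar>2 * (real (q (b k)) / real p) - 1\<bar> \<le> \<rho> * 1"
      using \<rho> by (intro mult_left_mono) auto
    then show ?thesis using \<rho> by (simp add: X_def abs_mult)
  qed
  define b' where "b' = the_inv_into I b"
  have b': "b' i \<in> I" "b (b' i) = i" if "i < n" for i
  proof -
    have "i \<in> b ` I" using b that by (auto simp: bij_betw_def)
    then obtain k where k: "k \<in> I" "b k = i" by blast
    then have "b' i = k"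
      using b the_inv_into_f_f[of b I k] by (simp add: b'_def bij_betw_def)
    with k show "b' i \<in> I" "b (b' i) = i" by simp_all
  qed
  \<comment> \<open>Label 1 means that \<open>f\<close> pushes coordinate \<open>i\<close> down. On
    the two faces the label is forced as Kuhn's lemma demands; this agrees with the direction of
    \<open>f\<close> there because \<open>f\<close> maps the cube to itself.\<close>
  define lab where "lab q i = (if q i = p \<or> (q i \<noteq> 0 \<and> f (X q) (b' i) < X q (b' i)) then 1 else (0::nat))" for q i
  obtain q where q: "\<forall>i<n. q i < p"
    and rs: "\<forall>i<n. \<exists>r s. (\<forall>j<n. q j \<le> r j \<and> r j \<le> q j + 1) \<and>
      (\<forall>j<n. q j \<le> s j \<and> s j \<le> q j + 1) \<and> lab r i \<noteq> lab s i"
    by (rule kuhn_lemma[OF p0', of n lab]) (use p0' in \<open>auto simp: lab_def\<close>)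
  \<comment> \<open>In each coordinate the cell at \<open>q\<close> has vertices with both labels,
    so \<open>f x k - x k\<close> is nonnegative at one of them and nonpositive at another.\<close>
  have "\<bar>f (X q) k - X q k\<bar> < \<epsilon>" if k: "k \<in> I" for k
  proof -
    define i where "i = b k"
    have i: "i < n" "b' i = k"
      using bI[OF k] b k by (auto simp: i_def b'_def bij_betw_def the_inv_into_f_f)
    obtain r s where r: "\<And>j. j < n \<Longrightarrow> q j \<le> r j \<and> r j \<le> q j + 1"
      and s: "\<And>j. j < n \<Longrightarrow> q j \<le> s j \<and> s j \<le> q j + 1" and l: "lab r i = 0" "lab s i = 1"
    proof -
      obtain r s where *: "\<forall>j<n. q j \<le> r j \<and> r j \<le> q j + 1"
        "\<forall>j<n. q j \<le> s j \<and> s j \<le> q j + 1" "lab r i \<noteq> lab s i"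
        using rs i by blast
      consider "lab r i = 0" "lab s i = 1" | "lab s i = 0" "lab r i = 1"
        using *(3) unfolding lab_def by (auto split: if_splits)
      then show ?thesis
        by cases (use *(1,2) that[of r s] that[of s r] in auto)
    qed
    have le: "\<forall>i<n. q i \<le> p" "\<forall>i<n. r i \<le> p" "\<forall>i<n. s i \<le> p"
    proof -
      show "\<forall>i<n. q i \<le> p" using q by (simp add: less_imp_le)
      have "u i \<le> p" if "i < n" "\<And>j. j < n \<Longrightarrow> q j \<le> u j \<and> u j \<le> q j + 1" for u i
        using that(2)[OF that(1)] q that(1) by (metis Suc_eq_plus1 Suc_leI le_trans)
      from this[OF _ r] this[OF _ s] show "\<forall>i<n. r i \<le> p" "\<forall>i<n. s i \<le> p" by simp_all
    qed
    have step: "X q j \<le> X u j \<and> X u j \<le> X q j + 2 * \<rho> / real p"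
      if "j \<in> I" "\<And>j. j < n \<Longrightarrow> q j \<le> u j \<and> u j \<le> q j + 1" for u j
    proof -
      have "real (q (b j)) \<le> real (u (b j))" "real (u (b j)) \<le> real (q (b j)) + 1"
        using that(2)[OF bI[OF that(1)]] by auto
      then have *: "real (q (b j)) / real p \<le> real (u (b j)) / real p" "real (u (b j)) / real p \<le> real (q (b j)) / real p + 1 / real p"
        using p0 by (simp_all add: field_simps)
      have "\<rho> * (real (q (b j)) / real p) \<le> \<rho> * (real (u (b j)) / real p)"
        "\<rho> * (real (u (b j)) / real p) \<le> \<rho> * (real (q (b j)) / real p + 1 / real p)"
        using * \<rho> by (simp_all only: mult_left_mono less_imp_le)
      moreover have "X v j = 2 * (\<rho> * (real (v (b j)) / real p)) - \<rho>" for v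
        by (simp add: X_def right_diff_distrib)
      moreover have "2 * \<rho> / real p = 2 * (\<rho> * (1 / real p))" by simp
      ultimately show ?thesis by (simp only: distrib_left) linarith
    qed
    have near: "\<bar>f (X u) k - f (X q) k\<bar> < \<epsilon> / 2"
      if u: "\<And>j. j < n \<Longrightarrow> q j \<le> u j \<and> u j \<le> q j + 1" "\<forall>i<n. u i \<le> p" for u
    proof (rule close)
      show "\<forall>k\<in>I. \<bar>X u k - X q k\<bar> < \<delta>"
      proof
        fix k assume "k \<in> I"
        from step[OF this u(1)] mesh(1) show "\<bar>X u k - X q k\<bar> < \<delta>" by linarith
      qed
    qed (use Xcube le u k in auto)
    have fr: "X r k \<le> f (X r) k"
    proof (cases "r i = 0")
      case True
      then have "X r k = - \<rho>" by (simp add: X_def i_def)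
      moreover have "\<bar>f (X r) k\<bar> \<le> \<rho>" by (rule maps) (use Xcube le(2) k in auto)
      ultimately show ?thesis by linarith
    next
      case False
      then show ?thesis using l(1) i by (auto simp: lab_def split: if_splits)
    qed
    have fs: "f (X s) k \<le> X s k"
    proof (cases "s i = p")
      case True
      then have "X s k = \<rho>" using p0 by (simp add: X_def i_def)
      moreover have "\<bar>f (X s) k\<bar> \<le> \<rho>" by (rule maps) (use Xcube le(3) k in auto)
      ultimately show ?thesis by linarith
    next
      case False
      then show ?thesis using l(2) i by (auto simp: lab_def split: if_splits)
    qed
    show ?thesis
      using near[OF r le(2)] near[OF s le(3)] fr fs step[OF k r] step[OF k s] mesh by linarith
  qed
  then show ?thesis
    using Xcube[of q] q by (intro exI[of _ "X q"]) (auto intro: less_imp_le)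
qed

text \<open>A limit point of approximate fixed points is fixed. Continuity is spelled out on
  \<open>I\<close>, since a point of the cube matters only through its coordinates in
  \<open>I\<close>.\<close>

lemma fixpoint_cube:
  fixes f :: "('k \<Rightarrow> real) \<Rightarrow> 'k \<Rightarrow> real"
  assumes I: "finite I" and \<rho>: "\<rho> > 0"
    and maps: "\<And>x i. (\<forall>k\<in>I. \<bar>x k\<bar> \<le> \<rho>) \<Longrightarrow> i \<in> I \<Longrightarrow> \<bar>f x i\<bar> \<le> \<rho>"
    and uc: "\<And>\<epsilon>. \<epsilon> > 0 \<Longrightarrow> \<exists>\<delta>>0. \<forall>x y. (\<forall>k\<in>I. \<bar>x k\<bar> \<le> \<rho>) \<longrightarrow> (\<forall>k\<in>I. \<bar>y k\<bar> \<le> \<rho>) \<longrightarrow>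
            (\<forall>k\<in>I. \<bar>x k - y k\<bar> < \<delta>) \<longrightarrow> (\<forall>k\<in>I. \<bar>f x k - f y k\<bar> < \<epsilon>)"
  shows "\<exists>x. (\<forall>k\<in>I. \<bar>x k\<bar> \<le> \<rho>) \<and> (\<forall>i\<in>I. f x i = x i)"
proof -
  have "\<exists>x. (\<forall>k. \<bar>x k\<bar> \<le> \<rho>) \<and> (\<forall>i\<in>I. \<bar>f x i - x i\<bar> < 1 / real (Suc n))" for n
  proof -
    define e where "e = 1 / real (Suc n)"
    have e: "e > 0" by (simp add: e_def)
    obtain x where x: "\<forall>k\<in>I. \<bar>x k\<bar> \<le> \<rho>" "\<forall>i\<in>I. \<bar>f x i - x i\<bar> < e / 2"
      using approx_fixpoint_cube[OF I \<rho> _ maps uc, of "e / 2"] e by auto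
    obtain \<delta> where \<delta>: "\<delta> > 0" "\<forall>x y. (\<forall>k\<in>I. \<bar>x k\<bar> \<le> \<rho>) \<longrightarrow> (\<forall>k\<in>I. \<bar>y k\<bar> \<le> \<rho>) \<longrightarrow>
            (\<forall>k\<in>I. \<bar>x k - y k\<bar> < \<delta>) \<longrightarrow> (\<forall>k\<in>I. \<bar>f x k - f y k\<bar> < e / 2)"
      using uc[of "e / 2"] e by auto
    define y where "y k = (if k \<in> I then x k else 0)" for k
    have "\<forall>k\<in>I. \<bar>f x k - f y k\<bar> < e / 2"
      using \<delta> x(1) by (auto simp: y_def)
    then have *: "\<bar>f x i - f y i\<bar> < e / 2" "\<bar>f x i - x i\<bar> < e / 2" if "i \<in> I" for i
      using x(2) that by blast+
    have "\<bar>f y i - y i\<bar> < e" if "i \<in> I" for i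
      using *[OF that] that unfolding y_def abs_less_iff by simp
    then show ?thesis using x(1) \<rho> by (intro exI[of _ y]) (auto simp: y_def e_def)
  qed
  then obtain x where x: "\<And>n k. \<bar>x n k\<bar> \<le> \<rho>" "\<And>n i. i \<in> I \<Longrightarrow> \<bar>f (x n) i - x n i\<bar> < 1 / real (Suc n)"
    by metis
  \<comment> \<open>Bolzano-Weierstrass with one subsequence for all coordinates in
    \<open>I\<close>.\<close>
  have "\<forall>d\<subseteq>I. \<exists>l::'k\<Rightarrow>real. \<exists>r. strict_mono r \<and>
    (\<forall>\<epsilon>>0. eventually (\<lambda>n. \<forall>i\<in>d. dist (x (r n) i) (l i) < \<epsilon>) sequentially)"
  proof (rule compact_lemma_general[where unproj = "\<lambda>e. e" and proj = "\<lambda>x i. x i"])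
    fix k assume "k \<in> I"
    show "bounded ((\<lambda>x. x k) ` range x)"
      using x(1) by (auto simp: bounded_iff)
  qed (use I in auto)
  then obtain l r where r: "strict_mono r"
    and lim: "\<And>\<epsilon>. \<epsilon> > 0 \<Longrightarrow> eventually (\<lambda>n. \<forall>i\<in>I. dist (x (r n) i) (l i) < \<epsilon>) sequentially"
    by blast
  have tend: "(\<lambda>n. x (r n) i) \<longlonglongrightarrow> l i" if "i \<in> I" for i
  proof (rule tendstoI)
    fix \<epsilon> :: real assume "\<epsilon> > 0"
    from lim[OF this] show "\<forall>\<^sub>F n in sequentially. dist (x (r n) i) (l i) < \<epsilon>"
      by eventually_elim (use that in auto)
  qed
  have lcube: "\<bar>l i\<bar> \<le> \<rho>" if "i \<in> I" for i
    using x(1) by (intro tendsto_upperbound[OF tendsto_rabs[OF tend[OF that]]]) auto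
  have "f l i = l i" if i: "i \<in> I" for i
  proof -
    have "(\<lambda>n. f (x (r n)) i) \<longlonglongrightarrow> f l i"
    proof (rule tendstoI)
      fix \<epsilon> :: real assume "\<epsilon> > 0"
      then obtain \<delta> where "\<delta> > 0" and \<delta>: "\<forall>x y. (\<forall>k\<in>I. \<bar>x k\<bar> \<le> \<rho>) \<longrightarrow> (\<forall>k\<in>I. \<bar>y k\<bar> \<le> \<rho>) \<longrightarrow>
            (\<forall>k\<in>I. \<bar>x k - y k\<bar> < \<delta>) \<longrightarrow> (\<forall>k\<in>I. \<bar>f x k - f y k\<bar> < \<epsilon>)"
        using uc[of \<epsilon>] by auto
      show "\<forall>\<^sub>F n in sequentially. dist (f (x (r n)) i) (f l i) < \<epsilon>"
        using lim[OF \<open>\<delta> > 0\<close>] by eventually_elim (use \<delta> lcube x(1) i in \<open>auto simp: dist_real_def\<close>)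
    qed
    then have "(\<lambda>n. f (x (r n)) i - x (r n) i) \<longlonglongrightarrow> f l i - l i"
      by (intro tendsto_diff tend i)
    moreover have "(\<lambda>n. f (x (r n)) i - x (r n) i) \<longlonglongrightarrow> 0"
    proof (rule Lim_null_comparison)
      show "\<forall>\<^sub>F n in sequentially. norm (f (x (r n)) i - x (r n) i) \<le> 1 / real (Suc (r n))"
        by (intro always_eventually allI) (use x(2)[OF i] in \<open>auto intro: less_imp_le\<close>)
      show "(\<lambda>n. 1 / real (Suc (r n))) \<longlonglongrightarrow> 0"
        using LIMSEQ_subseq_LIMSEQ[OF lim_1_over_n[THEN LIMSEQ_Suc] r] by (simp add: o_def)
    qed
    ultimately show ?thesis
      using LIMSEQ_unique by fastforce
  qed
  with lcube show ?thesis by blast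
qed

section \<open>Density of ReLU fields\<close>

definition relu_class :: "(real ^ 'n \<Rightarrow> real ^ 'n) set" where
  "relu_class = {V. \<exists>p w a b. V = relu_field p w a b}"

text \<open>A real-valued network enters as all the fields \<open>g x *\<^sub>R w\<close>: sums
  reduce to \<open>relu_class_add\<close>, a constant factor moves into \<open>w\<close>, and a
  vector field is assembled from its coordinates.\<close>

definition scalar_relu :: "(real ^ 'n \<Rightarrow> real) \<Rightarrow> bool" where
  "scalar_relu g \<longleftrightarrow> (\<forall>w. (\<lambda>x. g x *\<^sub>R w) \<in> relu_class)"

lemma relu_class_lipschitz:
  assumes "V \<in> relu_class"
  obtains L where "L-lipschitz_on UNIV V"
  using assms relu_field_lipschitz unfolding relu_class_def by blast

lemma relu_class_0: "(\<lambda>x. 0) \<in> relu_class"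
  unfolding relu_class_def by (rule CollectI, rule exI[of _ 0]) (simp add: relu_field_def fun_eq_iff)

lemma relu_class_add:
  fixes V W :: "real ^ 'n \<Rightarrow> real ^ 'n"
  assumes "V \<in> relu_class" "W \<in> relu_class"
  shows "(\<lambda>x. V x + W x) \<in> relu_class"
proof -
  obtain p w a b q w' a' b' where V: "V = relu_field p w a b" and W: "W = relu_field q w' a' b'"
    using assms unfolding relu_class_def by blast
  define j where "j f g i = (if i \<le> p then f i else g (i - p))" for f g :: "nat \<Rightarrow> real ^ 'n" and i
  have "(\<lambda>x. V x + W x) = relu_field (p + q) (j w w') (j a a') (\<lambda>i. if i \<le> p then b i else b' (i - p))"
  proof
    fix x
    let ?t = "\<lambda>i. pos_part (j a a' i \<bullet> x + (if i \<le> p then b i else b' (i - p))) *\<^sub>R j w w' i"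
    have "{1..p+q} = {1..p} \<union> {1+p..q+p}" by auto
    then have "(\<Sum>i=1..p+q. ?t i) = (\<Sum>i=1..p. ?t i) + (\<Sum>i=1+p..q+p. ?t i)"
      by (simp add: sum.union_disjoint)
    also have "(\<Sum>i=1+p..q+p. ?t i) = (\<Sum>i=1..q. ?t (i + p))"
      by (rule sum.shift_bounds_cl_nat_ivl)
    also have "\<dots> = W x" unfolding W relu_field_def by (rule sum.cong) (auto simp: j_def)
    also have "(\<Sum>i=1..p. ?t i) = V x" unfolding V relu_field_def by (rule sum.cong) (auto simp: j_def)
    finally show "V x + W x = relu_field (p + q) (j w w') (j a a') (\<lambda>i. if i \<le> p then b i else b' (i - p)) x"
      by (simp add: relu_field_def)
  qed
  then show ?thesis unfolding relu_class_def by blast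
qed

lemma relu_class_sum:
  "(\<And>i. i \<in> I \<Longrightarrow> V i \<in> relu_class) \<Longrightarrow> (\<lambda>x. \<Sum>i\<in>I. V i x) \<in> relu_class"
  by (induction I rule: infinite_finite_induct) (auto intro: relu_class_0 relu_class_add)

lemma scalar_relu_pos_part: "scalar_relu (\<lambda>x. pos_part (a \<bullet> x + b))"
  unfolding scalar_relu_def relu_class_def
proof (intro allI CollectI)
  fix w
  show "\<exists>p w' a' b'. (\<lambda>x. pos_part (a \<bullet> x + b) *\<^sub>R w) = relu_field p w' a' b'"
    by (rule exI[of _ 1], rule exI[of _ "\<lambda>_. w"], rule exI[of _ "\<lambda>_. a"], rule exI[of _ "\<lambda>_. b"])
      (simp add: relu_field_def fun_eq_iff)
qed

lemma scalar_relu_add: "scalar_relu f \<Longrightarrow> scalar_relu g \<Longrightarrow> scalar_relu (\<lambda>x. f x + g x)"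
  using relu_class_add by (fastforce simp: scalar_relu_def scaleR_add_left)

lemma scalar_relu_cmult:
  assumes "scalar_relu f" shows "scalar_relu (\<lambda>x. c * f x)"
  unfolding scalar_relu_def
proof
  fix w
  have "(\<lambda>x. f x *\<^sub>R c *\<^sub>R w) \<in> relu_class" using assms by (simp only: scalar_relu_def)
  then show "(\<lambda>x. (c * f x) *\<^sub>R w) \<in> relu_class" by (simp add: mult.commute)
qed

lemma scalar_relu_const: "scalar_relu (\<lambda>x. c)"
  using scalar_relu_cmult[OF scalar_relu_pos_part[of 0 1], of c] by (simp add: pos_part_def)

lemma scalar_relu_sum: "(\<And>i. i \<in> I \<Longrightarrow> scalar_relu (f i)) \<Longrightarrow> scalar_relu (\<lambda>x. \<Sum>i\<in>I. f i x)"
  by (induction I rule: infinite_finite_induct) (auto intro: scalar_relu_const scalar_relu_add)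

text \<open>Piecewise linear interpolation with a mesh below the modulus of continuity for
  \<epsilon> / 2. The interpolant is a constant plus multiples of ramps, and a ramp \<phi> is a
  difference of two shifted ReLUs.\<close>

lemma scalar_relu_ridge_approx:
  fixes f :: "real \<Rightarrow> real" and a :: "real ^ 'n"
  assumes f: "continuous_on {-R..R} f" and R: "R > 0" and \<epsilon>: "\<epsilon> > 0"
  shows "\<exists>g. scalar_relu g \<and> (\<forall>x. \<bar>a \<bullet> x\<bar> \<le> R \<longrightarrow> \<bar>f (a \<bullet> x) - g x\<bar> < \<epsilon>)"
proof -
  have "uniformly_continuous_on {-R..R} f"
    using f by (intro compact_uniformly_continuous) auto
  then obtain \<delta> where \<delta>: "\<delta> > 0"
    and osc: "\<And>u v. \<lbrakk>u \<in> {-R..R}; v \<in> {-R..R}; \<bar>u - v\<bar> < \<delta>\<rbrakk> \<Longrightarrow> \<bar>f u - f v\<bar> < \<epsilon> / 2"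
    using \<epsilon> unfolding uniformly_continuous_on_def dist_real_def by (metis half_gt_zero)
  obtain n :: nat where n: "2 * R / \<delta> < real n"
    using reals_Archimedean2 by blast
  have "0 < 2 * R / \<delta>" using \<delta> R by simp
  then have n0: "real n > 0" using n by linarith
  define h where "h = 2 * R / real n"
  have h: "h > 0" "h < \<delta>" "real n * h = 2 * R"
    using n n0 \<delta> R by (simp_all add: h_def divide_less_eq mult.commute)
  define s where "s k = real k * h - R" for k
  define \<phi> where "\<phi> u = pos_part u - pos_part (u - 1)" for u
  have \<phi>: "u \<le> 0 \<Longrightarrow> \<phi> u = 0" "1 \<le> u \<Longrightarrow> \<phi> u = 1" "0 \<le> \<phi> u" "\<phi> u \<le> 1" for u
    by (auto simp: \<phi>_def pos_part_def)
  \<comment> \<open>\<open>G m\<close> interpolates \<open>f\<close> at the nodes \<open>s 0, \<dots>, s m\<close> and is constant to the right of \<open>s m\<close>.\<close>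
  define G where "G m u = f (-R) + (\<Sum>k<m. (f (s (Suc k)) - f (s k)) * \<phi> ((u - s k) / h))" for m u
  have s_Suc: "s (Suc k) = s k + h" for k by (simp add: s_def algebra_simps)
  have s_in: "s k \<in> {-R..R}" if "k \<le> n" for k
  proof -
    have "real k * h \<le> real n * h" using that h by (intro mult_right_mono) auto
    then show ?thesis using h by (auto simp: s_def)
  qed
  \<comment> \<open>Constancy to the right of \<open>s m\<close> is carried along because the next
    ramp starts from the value \<open>f (s m)\<close>; between the nodes \<open>f\<close> and the
    new interpolant each deviate from it by less than \<epsilon> / 2.\<close>
  have "m \<le> n \<Longrightarrow> (\<forall>u. s m \<le> u \<longrightarrow> G m u = f (s m)) \<and> (\<forall>u. -R \<le> u \<longrightarrow> u \<le> s m \<longrightarrow> \<bar>f u - G m u\<bar> < \<epsilon>)" for m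
  proof (induction m)
    case 0
    show ?case using \<epsilon> by (auto simp: G_def s_def)
  next
    case (Suc m)
    then have IH: "\<And>u. s m \<le> u \<Longrightarrow> G m u = f (s m)"
      "\<And>u. -R \<le> u \<Longrightarrow> u \<le> s m \<Longrightarrow> \<bar>f u - G m u\<bar> < \<epsilon>" by auto
    have G_Suc: "G (Suc m) u = G m u + (f (s (Suc m)) - f (s m)) * \<phi> ((u - s m) / h)" for u
      by (simp add: G_def)
    show ?case
    proof (intro conjI allI impI)
      fix u assume u: "s (Suc m) \<le> u"
      then have "1 \<le> (u - s m) / h" using h by (simp add: s_Suc field_simps)
      moreover have "s m \<le> u" using u h by (simp add: s_Suc)
      ultimately show "G (Suc m) u = f (s (Suc m))" by (simp add: G_Suc IH \<phi>)
    next
      fix u assume u: "-R \<le> u" "u \<le> s (Suc m)"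
      show "\<bar>f u - G (Suc m) u\<bar> < \<epsilon>"
      proof (cases "u \<le> s m")
        case True
        then have "(u - s m) / h \<le> 0" using h by (simp add: divide_le_0_iff)
        then show ?thesis using IH(2)[OF u(1) True] by (simp add: G_Suc \<phi>)
      next
        case False
        have sm: "s m \<in> {-R..R}" "s (Suc m) \<in> {-R..R}" using s_in Suc.prems by auto
        have 1: "\<bar>f u - f (s m)\<bar> < \<epsilon> / 2"
          using sm u False h by (intro osc) (auto simp: s_Suc)
        have 2: "\<bar>f (s (Suc m)) - f (s m)\<bar> < \<epsilon> / 2"
          using sm h by (intro osc) (auto simp: s_Suc)
        have "\<bar>(f (s (Suc m)) - f (s m)) * \<phi> ((u - s m) / h)\<bar> \<le> \<bar>f (s (Suc m)) - f (s m)\<bar> * 1"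
          unfolding abs_mult using \<phi> by (intro mult_left_mono) auto
        also have "\<dots> < \<epsilon> / 2" using 2 by simp
        finally have "\<bar>(f (s (Suc m)) - f (s m)) * \<phi> ((u - s m) / h)\<bar> < \<epsilon> / 2" .
        moreover have "G m u = f (s m)" using IH(1) False by simp
        ultimately show ?thesis
          using 1 abs_triangle_ineq4[of "f u - f (s m)" "(f (s (Suc m)) - f (s m)) * \<phi> ((u - s m) / h)"]
          unfolding G_Suc by (simp add: diff_diff_eq)
      qed
    qed
  qed
  from this[of n] have *: "\<bar>f u - G n u\<bar> < \<epsilon>" if "\<bar>u\<bar> \<le> R" for u
    using that h(3) by (auto simp: s_def)
  have "scalar_relu (\<lambda>x. \<phi> ((a \<bullet> x - c) / h))" for c
  proof -
    have "scalar_relu (\<lambda>x. pos_part ((a /\<^sub>R h) \<bullet> x + (- c / h)) + -1 * pos_part ((a /\<^sub>R h) \<bullet> x + (- c / h - 1)))"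
      by (intro scalar_relu_add scalar_relu_cmult scalar_relu_pos_part)
    moreover have "(a \<bullet> x - c) / h = (a /\<^sub>R h) \<bullet> x + (- c / h)" for x
      by (simp add: divide_inverse algebra_simps)
    ultimately show ?thesis by (simp add: \<phi>_def add_diff_eq)
  qed
  then have "scalar_relu (\<lambda>x. G n (a \<bullet> x))"
    unfolding G_def by (intro scalar_relu_add scalar_relu_const scalar_relu_sum scalar_relu_cmult)
  with * show ?thesis by blast
qed

text \<open>An algebra for Stone-Weierstrass made of ridge functions: a product of two exponentials
  of linear forms is again one, whereas a product of ReLUs is not a sum of ReLUs. Each summand
  depends on one linear form, so one-dimensional approximation applies to it.\<close>

inductive exp_sum :: "('a::real_inner \<Rightarrow> real) \<Rightarrow> bool" where
  exp_sum_exp: "exp_sum (\<lambda>x. c * exp (a \<bullet> x))"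
| exp_sum_add: "exp_sum f \<Longrightarrow> exp_sum g \<Longrightarrow> exp_sum (\<lambda>x. f x + g x)"

lemma exp_sum_continuous: "exp_sum f \<Longrightarrow> continuous_on S f"
  by (induction rule: exp_sum.induct) (auto intro!: continuous_intros)

lemma exp_sum_mult: "exp_sum f \<Longrightarrow> exp_sum g \<Longrightarrow> exp_sum (\<lambda>x. f x * g x)"
proof (induction rule: exp_sum.induct)
  case (exp_sum_exp c a)
  then show ?case
  proof (induction rule: exp_sum.induct)
    case (exp_sum_exp d b)
    show ?case using exp_sum.exp_sum_exp[of "c * d" "a + b"]
      by (simp add: inner_add_left exp_add mult_ac)
  next
    case (exp_sum_add f g)
    then show ?case using exp_sum.exp_sum_add by (fastforce simp: distrib_left)
  qed
next
  case (exp_sum_add f1 f2)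
  then show ?case using exp_sum.exp_sum_add by (fastforce simp: distrib_right)
qed

lemma scalar_relu_exp_sum_approx:
  fixes f :: "real ^ 'n \<Rightarrow> real"
  assumes "exp_sum f" and K: "bounded K"
  shows "\<epsilon> > 0 \<Longrightarrow> \<exists>g. scalar_relu g \<and> (\<forall>x\<in>K. \<bar>f x - g x\<bar> < \<epsilon>)"
  using assms(1)
proof (induction arbitrary: \<epsilon> rule: exp_sum.induct)
  case (exp_sum_exp c a)
  obtain B where B: "B > 0" "\<And>x. x \<in> K \<Longrightarrow> norm x \<le> B"
    using K bounded_pos by blast
  \<comment> \<open>Cauchy-Schwarz bounds \<open>a \<bullet> x\<close> on \<open>K\<close> by
    \<open>norm a * B\<close>; the 1 keeps \<open>R\<close> positive when
    \<open>a = 0\<close>.\<close>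
  define R where "R = norm a * B + 1"
  have "R > 0" using B by (simp add: R_def add_nonneg_pos)
  moreover have "continuous_on {-R..R} (\<lambda>u. c * exp u)" by (intro continuous_intros)
  ultimately obtain g where g: "scalar_relu g" "\<And>x. \<bar>a \<bullet> x\<bar> \<le> R \<Longrightarrow> \<bar>c * exp (a \<bullet> x) - g x\<bar> < \<epsilon>"
    using scalar_relu_ridge_approx[of R "\<lambda>u. c * exp u" \<epsilon> a] exp_sum_exp by auto
  have "\<bar>a \<bullet> x\<bar> \<le> R" if "x \<in> K" for x
  proof -
    have "\<bar>a \<bullet> x\<bar> \<le> norm a * norm x" by (rule Cauchy_Schwarz_ineq2)
    also have "\<dots> \<le> norm a * B" using B that by (intro mult_left_mono) auto
    finally show ?thesis by (simp add: R_def)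
  qed
  with g show ?case by blast
next
  case (exp_sum_add f1 f2)
  obtain g1 where g1: "scalar_relu g1" "\<And>x. x \<in> K \<Longrightarrow> \<bar>f1 x - g1 x\<bar> < \<epsilon> / 2"
    using exp_sum_add.IH(1)[of "\<epsilon> / 2"] exp_sum_add.prems by auto
  obtain g2 where g2: "scalar_relu g2" "\<And>x. x \<in> K \<Longrightarrow> \<bar>f2 x - g2 x\<bar> < \<epsilon> / 2"
    using exp_sum_add.IH(2)[of "\<epsilon> / 2"] exp_sum_add.prems by auto
  show ?case
  proof (intro exI[of _ "\<lambda>x. g1 x + g2 x"] conjI ballI)
    show "scalar_relu (\<lambda>x. g1 x + g2 x)" using g1 g2 by (intro scalar_relu_add)
    show "\<bar>f1 x + f2 x - (g1 x + g2 x)\<bar> < \<epsilon>" if "x \<in> K" for x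
      using g1(2)[OF that] g2(2)[OF that] by linarith
  qed
qed

lemma scalar_relu_dense:
  fixes f :: "real ^ 'n \<Rightarrow> real"
  assumes K: "compact K" and f: "continuous_on K f" and \<epsilon>: "\<epsilon> > 0"
  obtains g where "scalar_relu g" "\<And>x. x \<in> K \<Longrightarrow> \<bar>f x - g x\<bar> < \<epsilon>"
proof -
  have "\<exists>g. exp_sum g \<and> (\<forall>x\<in>K. \<bar>f x - g x\<bar> < \<epsilon> / 2)"
  proof (rule Stone_Weierstrass_HOL[OF K _ _ _ _ _ f])
    show "exp_sum (\<lambda>x. c)" for c
      using exp_sum_exp[of c 0] by simp
    show "\<exists>f. exp_sum f \<and> f x \<noteq> f y" if "x \<in> K \<and> y \<in> K \<and> x \<noteq> y" for x y
    proof (intro exI conjI)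
      \<comment> \<open>The direction \<open>x - y\<close> separates the two points: the exponents
        differ by the square of \<open>norm (x - y)\<close>.\<close>
      show "exp_sum (\<lambda>z. 1 * exp ((x - y) \<bullet> z))" by (rule exp_sum_exp)
      have "(x - y) \<bullet> (x - y) \<noteq> 0" using that by simp
      then show "1 * exp ((x - y) \<bullet> x) \<noteq> 1 * exp ((x - y) \<bullet> y)"
        by (simp add: inner_diff_right)
    qed
  qed (use \<epsilon> in \<open>auto intro: exp_sum_continuous exp_sum_add exp_sum_mult\<close>)
  then obtain e where e: "exp_sum e" "\<And>x. x \<in> K \<Longrightarrow> \<bar>f x - e x\<bar> < \<epsilon> / 2" by blast
  obtain g where g: "scalar_relu g" "\<And>x. x \<in> K \<Longrightarrow> \<bar>e x - g x\<bar> < \<epsilon> / 2"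
    using scalar_relu_exp_sum_approx[OF e(1) compact_imp_bounded[OF K], of "\<epsilon> / 2"] \<epsilon> by auto
  have "\<bar>f x - g x\<bar> < \<epsilon>" if "x \<in> K" for x
    using e(2)[OF that] g(2)[OF that] by linarith
  with g(1) show ?thesis by (rule that)
qed

lemma relu_class_dense:
  fixes F :: "real ^ 'n \<Rightarrow> real ^ 'n"
  assumes K: "compact K" and F: "continuous_on K F" and \<epsilon>: "\<epsilon> > 0"
  obtains V where "V \<in> relu_class" "\<And>x. x \<in> K \<Longrightarrow> norm (F x - V x) < \<epsilon>"
proof -
  define d where "d = real DIM(real ^ 'n)"
  have d: "d > 0" by (simp add: d_def)
  have "\<exists>g. scalar_relu g \<and> (\<forall>x\<in>K. \<bar>F x \<bullet> e - g x\<bar> < \<epsilon> / d)" for e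
  proof -
    have "continuous_on K (\<lambda>x. F x \<bullet> e)" using F by (intro continuous_intros)
    from scalar_relu_dense[OF K this, of "\<epsilon> / d"] \<epsilon> d show ?thesis by (metis divide_pos_pos)
  qed
  then obtain g where g: "\<And>e. scalar_relu (g e)" "\<And>e x. x \<in> K \<Longrightarrow> \<bar>F x \<bullet> e - g e x\<bar> < \<epsilon> / d"
    by metis
  show ?thesis
  proof (rule that[of "\<lambda>x. \<Sum>e\<in>Basis. g e x *\<^sub>R e"])
    show "(\<lambda>x. \<Sum>e\<in>Basis. g e x *\<^sub>R e) \<in> relu_class"
      using g(1) by (intro relu_class_sum) (simp add: scalar_relu_def)
    fix x assume x: "x \<in> K"
    have "norm (F x - (\<Sum>e\<in>Basis. g e x *\<^sub>R e)) = norm (\<Sum>e\<in>Basis. (F x \<bullet> e - g e x) *\<^sub>R e)"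
      by (simp add: scaleR_diff_left sum_subtractf euclidean_representation)
    also have "\<dots> \<le> (\<Sum>e\<in>(Basis :: (real ^ 'n) set). \<bar>F x \<bullet> e - g e x\<bar>)"
      by (rule order_trans[OF norm_sum]) (auto intro!: sum_mono)
    also have "\<dots> < (\<Sum>e\<in>(Basis :: (real ^ 'n) set). \<epsilon> / d)"
      using g(2)[OF x] by (intro sum_strict_mono) auto
    also have "\<dots> = \<epsilon>" using d by (simp add: d_def)
    finally show "norm (F x - (\<Sum>e\<in>Basis. g e x *\<^sub>R e)) < \<epsilon>" .
  qed
qed

section \<open>Global flows of Lipschitz fields\<close>

text \<open>The oriented integral from \<open>0\<close> to \<open>t\<close>: one of the two intervals is degenerate.\<close>

definition signed_integral :: "(real \<Rightarrow> 'a::banach) \<Rightarrow> real \<Rightarrow> 'a" where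
  "signed_integral g t = integral {0..t} g - integral {t..0} g"

lemma signed_integral_0 [simp]: "signed_integral g 0 = 0"
  by (simp add: signed_integral_def)

lemma has_vector_derivative_signed_integral:
  fixes g :: "real \<Rightarrow> 'a::banach"
  assumes g: "continuous_on UNIV g"
  shows "(signed_integral g has_vector_derivative g t) (at t)"
proof -
  \<comment> \<open>A window with 0 and \<open>t\<close> in its interior: on it the signed integral
    is an ordinary integral from \<open>a\<close> minus a constant, whatever the sign of
    \<open>t\<close>.\<close>
  define a b where "a = - \<bar>t\<bar> - 1" and "b = \<bar>t\<bar> + 1"
  have ab: "a < 0" "0 < b" "a < t" "t < b" by (auto simp: a_def b_def)
  have int: "g integrable_on {c..d}" for c d
    by (intro integrable_continuous_real continuous_on_subset[OF g]) auto
  have eq: "signed_integral g u = integral {a..u} g - integral {a..0} g" if "u \<in> {a<..<b}" for u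
  proof (cases "u \<ge> 0")
    case True
    then have "integral {u..0} g = 0" by (cases "u = 0") auto
    then show ?thesis
      using Henstock_Kurzweil_Integration.integral_combine[of a 0 u g] int ab True by (simp add: signed_integral_def algebra_simps)
  next
    case False
    then show ?thesis
      using Henstock_Kurzweil_Integration.integral_combine[of a u 0 g] int that by (simp add: signed_integral_def algebra_simps)
  qed
  have "((\<lambda>u. integral {a..u} g) has_vector_derivative g t) (at t within {a..b})"
    using ab by (intro integral_has_vector_derivative continuous_on_subset[OF g]) auto
  then have "((\<lambda>u. integral {a..u} g) has_vector_derivative g t) (at t)"
    using ab at_within_interior[of t "{a..b}"] by (simp add: interior_atLeastAtMost_real)
  then have "((\<lambda>u. integral {a..u} g - integral {a..0} g) has_vector_derivative g t) (at t)"
    by (auto intro: derivative_eq_intros)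
  then show ?thesis
    by (rule has_vector_derivative_transform_within_open[of _ _ _ "{a<..<b}"]) (use ab eq in auto)
qed

text \<open>Integration keeps the growth rate \<open>K\<close> and gains the factor 1 / K, as the
  majorant is the derivative of \<open>C / K * exp (K * u)\<close>. This gain makes the Picard
  operator contract in the weighted norm.\<close>

lemma norm_signed_integral_exp_bound:
  fixes g :: "real \<Rightarrow> 'a::banach"
  assumes g: "continuous_on UNIV g" and K: "K > 0" and C: "\<And>s. norm (g s) \<le> C * exp (K * \<bar>s\<bar>)"
  shows "norm (signed_integral g t) \<le> C / K * exp (K * \<bar>t\<bar>)"
proof -
  have C0: "C \<ge> 0" using order_trans[OF norm_ge_zero C[of 0]] by simp
  \<comment> \<open>The sign \<sigma> reflects the negative half-line onto the positive one.\<close>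
  have "norm (signed_integral g (\<sigma> * u)) \<le> C / K * exp (K * u)" if u: "u > 0" and \<sigma>: "\<bar>\<sigma>\<bar> = 1" for u \<sigma>
  proof -
    have d: "((\<lambda>u. signed_integral g (\<sigma> * u)) has_vector_derivative \<sigma> *\<^sub>R g (\<sigma> * x)) (at x)" for x
    proof -
      have "((\<lambda>u. \<sigma> * u) has_vector_derivative \<sigma>) (at x)"
        unfolding has_real_derivative_iff_has_vector_derivative[symmetric]
        by (auto intro!: derivative_eq_intros)
      from vector_diff_chain_at[OF this has_vector_derivative_signed_integral[OF g]]
      show ?thesis by (simp add: o_def)
    qed
    have e: "((\<lambda>u. C / K * exp (K * u)) has_vector_derivative C * exp (K * x)) (at x)" for x
      using K by (auto intro!: derivative_eq_intros simp: has_real_derivative_iff_has_vector_derivative[symmetric])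
    have "norm (signed_integral g (\<sigma> * u) - signed_integral g (\<sigma> * 0)) \<le> C / K * exp (K * u) - C / K * exp (K * 0)"
    proof (rule differentiable_bound_general[OF u _ _ d e])
      show "continuous_on {0..u} (\<lambda>u. signed_integral g (\<sigma> * u))"
        by (intro continuous_at_imp_continuous_on ballI has_vector_derivative_continuous[OF d])
      show "norm (\<sigma> *\<^sub>R g (\<sigma> * x)) \<le> C * exp (K * x)" if "0 < x" for x
        using C[of "\<sigma> * x"] \<sigma> that by (simp add: abs_mult)
    qed (use K in \<open>auto intro!: continuous_intros\<close>)
    moreover have "C / K \<ge> 0" using C0 K by simp
    ultimately show ?thesis by simp
  qed
  from this[of t 1] this[of "- t" "-1"] show ?thesis
    using C0 K by (cases "t = 0"; cases "t > 0") auto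
qed

lemma lipschitz_global_solution:
  fixes V :: "'a::banach \<Rightarrow> 'a" and x :: 'a
  assumes V: "L-lipschitz_on UNIV V"
  shows "\<exists>X. X 0 = x \<and> (\<forall>t. (X has_vector_derivative V (X t)) (at t))"
proof -
  have L: "L \<ge> 0" using V by (rule lipschitz_on_nonneg)
  \<comment> \<open>The weight \<open>exp (- K \<bar>t\<bar>)\<close> makes the integral operator a contraction on all of \<open>\<real>\<close> at once.\<close>
  define K where "K = 2 * L + 1"
  have K: "K > 0" "L / K \<le> 1 / 2" using L by (auto simp: K_def field_simps)
  have contV: "continuous_on S V" for S
    using lipschitz_on_continuous_on[OF V] continuous_on_subset by blast
  \<comment> \<open>A bounded continuous \<open>f\<close> encodes the curve \<open>Y f\<close>,
    which may grow like \<open>exp (K * \<bar>s\<bar>)\<close>; a fixed point of the operator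
    \<open>F\<close> below means that \<open>Y f\<close> solves the integral equation.\<close>
  define Y where "Y f s = x + exp (K * \<bar>s\<bar>) *\<^sub>R apply_bcontfun f s" for f :: "real \<Rightarrow>\<^sub>C 'a" and s
  have contVY: "continuous_on UNIV (\<lambda>s. V (Y f s))" for f
    unfolding Y_def by (intro continuous_on_compose2[OF contV[of UNIV]] continuous_intros) auto
  define G where "G f t = exp (- K * \<bar>t\<bar>) *\<^sub>R signed_integral (\<lambda>s. V (Y f s)) t" for f t
  have contS: "continuous_on UNIV (signed_integral (\<lambda>s. V (Y f s)))" for f
    by (intro continuous_at_imp_continuous_on ballI
        has_vector_derivative_continuous[OF has_vector_derivative_signed_integral[OF contVY]])
  have weight: "norm (exp (- K * \<bar>t\<bar>) *\<^sub>R v) \<le> c" if "norm v \<le> c * exp (K * \<bar>t\<bar>)" for t c and v :: 'a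
    using that by (simp add: exp_minus field_simps)
  have lip: "norm (V u - V v) \<le> L * norm (u - v)" for u v
    using lipschitz_onD[OF V, of u v] by (simp add: dist_norm)
  have G_in: "G f \<in> bcontfun" for f
  proof (rule bcontfun_normI)
    show "continuous_on UNIV (G f)"
      unfolding G_def by (intro continuous_intros contS)
    have "norm (V (Y f s)) \<le> (norm (V x) + L * norm f) * exp (K * \<bar>s\<bar>)" for s
    proof -
      have 1: "1 \<le> exp (K * \<bar>s\<bar>)" using K by simp
      have "norm (V (Y f s) - V x) \<le> L * (exp (K * \<bar>s\<bar>) * norm (apply_bcontfun f s))"
        using lip[of "Y f s" x] by (simp add: Y_def)
      also have "\<dots> \<le> L * (exp (K * \<bar>s\<bar>) * norm f)"
        using L norm_bounded[of f s] by (intro mult_left_mono) auto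
      finally have "norm (V (Y f s) - V x) \<le> L * norm f * exp (K * \<bar>s\<bar>)" by (simp add: mult_ac)
      moreover have "norm (V x) \<le> norm (V x) * exp (K * \<bar>s\<bar>)"
        using mult_left_mono[OF 1, of "norm (V x)"] by simp
      moreover have "norm (V (Y f s)) \<le> norm (V x) + norm (V (Y f s) - V x)"
        by (rule norm_triangle_sub)
      ultimately show ?thesis by (simp only: distrib_right)
    qed
    from norm_signed_integral_exp_bound[OF contVY K(1) this]
    show "norm (G f t) \<le> (norm (V x) + L * norm f) / K" for t
      unfolding G_def by (rule weight)
  qed
  define F where "F f = Bcontfun (G f)" for f
  have F: "apply_bcontfun (F f) = G f" for f
    unfolding F_def by (rule Bcontfun_inverse[OF G_in])
  have "dist (F f) (F g) \<le> 1 / 2 * dist f g" for f g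
  proof (rule dist_bound)
    fix t
    have sub: "signed_integral (\<lambda>s. V (Y f s)) t - signed_integral (\<lambda>s. V (Y g s)) t
        = signed_integral (\<lambda>s. V (Y f s) - V (Y g s)) t"
    proof -
      have "(\<lambda>s. V (Y h s)) integrable_on {c..d}" for h c d
        by (intro integrable_continuous_real continuous_on_subset[OF contVY]) auto
      then show ?thesis by (simp add: signed_integral_def integral_diff)
    qed
    have "norm (V (Y f s) - V (Y g s)) \<le> (L * dist f g) * exp (K * \<bar>s\<bar>)" for s
    proof -
      have "Y f s - Y g s = exp (K * \<bar>s\<bar>) *\<^sub>R (apply_bcontfun f s - apply_bcontfun g s)"
        by (simp add: Y_def scaleR_diff_right)
      then have "norm (V (Y f s) - V (Y g s)) \<le> L * (exp (K * \<bar>s\<bar>) * dist (apply_bcontfun f s) (apply_bcontfun g s))"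
        using lip[of "Y f s" "Y g s"] by (simp add: dist_norm)
      also have "\<dots> \<le> L * (exp (K * \<bar>s\<bar>) * dist f g)"
        using L dist_bounded[of f s g] by (intro mult_left_mono) auto
      finally show ?thesis by (simp add: mult_ac)
    qed
    moreover have "continuous_on UNIV (\<lambda>s. V (Y f s) - V (Y g s))"
      by (intro continuous_on_diff contVY)
    ultimately have "norm (signed_integral (\<lambda>s. V (Y f s) - V (Y g s)) t) \<le> (L * dist f g) / K * exp (K * \<bar>t\<bar>)"
      by (intro norm_signed_integral_exp_bound K(1))
    then
    have "norm (exp (- K * \<bar>t\<bar>) *\<^sub>R signed_integral (\<lambda>s. V (Y f s) - V (Y g s)) t) \<le> (L * dist f g) / K"
      by (rule weight)
    also have "\<dots> = (L / K) * dist f g" by simp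
    also have "\<dots> \<le> 1 / 2 * dist f g" by (intro mult_right_mono K) auto
    finally show "dist (apply_bcontfun (F f) t) (apply_bcontfun (F g) t) \<le> 1 / 2 * dist f g"
      unfolding F G_def by (simp only: sub dist_norm scaleR_diff_right[symmetric])
  qed
  then obtain f where f: "F f = f"
    using banach_fix_type[of "1 / 2" F] by auto
  have Yf: "Y f t = x + signed_integral (\<lambda>s. V (Y f s)) t" for t
  proof -
    have "apply_bcontfun f t = G f t" using F[of f] f by simp
    then show ?thesis unfolding Y_def[of f t] G_def by (simp add: exp_minus)
  qed
  have "(Y f has_vector_derivative V (Y f t)) (at t)" for t
  proof -
    have "((\<lambda>t. x + signed_integral (\<lambda>s. V (Y f s)) t) has_vector_derivative V (Y f t)) (at t)"
      using has_vector_derivative_signed_integral[OF contVY[of f], of t] by (auto intro: derivative_eq_intros)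
    moreover have "(\<lambda>t. x + signed_integral (\<lambda>s. V (Y f s)) t) = Y f"
      by (rule ext) (rule Yf[symmetric])
    ultimately show ?thesis by (simp only:)
  qed
  moreover have "Y f 0 = x" using Yf[of 0] by simp
  ultimately show ?thesis by blast
qed

lemma lipschitz_global_flow:
  fixes V :: "real ^ 'n \<Rightarrow> real ^ 'n"
  assumes "L-lipschitz_on UNIV V"
  obtains \<Phi> where "global_flow V \<Phi>"
proof -
  obtain X where "\<And>x. X x 0 = x \<and> (\<forall>t. (X x has_vector_derivative V (X x t)) (at t))"
    using lipschitz_global_solution[OF assms] by metis
  then have "global_flow V (\<lambda>t x. X x t)" by (simp add: global_flow_def)
  then show ?thesis by (rule that)
qed

text \<open>Gronwall's inequality, proved for the squared norm, which unlike the norm is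
  differentiable at 0. It yields continuous dependence on the parameters.\<close>

lemma norm_le_exp_of_deriv_bound:
  fixes z :: "real \<Rightarrow> 'a::real_inner"
  assumes z: "\<And>s. 0 \<le> s \<Longrightarrow> s \<le> T \<Longrightarrow> (z has_vector_derivative z' s) (at s)" and z0: "z 0 = 0"
    and bound: "\<And>s. 0 \<le> s \<Longrightarrow> s \<le> T \<Longrightarrow> norm (z' s) \<le> L * norm (z s) + c"
    and c: "c \<ge> 0" and L: "L \<ge> 0" and t: "0 \<le> t" "t \<le> T"
  shows "norm (z t) \<le> c * exp ((L + 1) * t)"
proof -
  \<comment> \<open>The mixed term \<open>2 * norm (z s) * c\<close> is at most
    \<open>(norm (z s))\<^sup>2 + c\<^sup>2\<close>, which adds 1 to \<open>2 * L\<close>; as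
    \<open>k \<ge> 1\<close>, the other \<open>c\<^sup>2\<close> is absorbed by the summand
    \<open>c\<^sup>2\<close> in \<open>u\<close>.\<close>
  define k where "k = 2 * L + 1"
  have k: "k \<ge> 1" using L by (simp add: k_def)
  define u where "u s = (z s \<bullet> z s + c\<^sup>2) * exp (- k * s)" for s
  have "u t \<le> u 0"
  proof (rule DERIV_nonpos_imp_nonincreasing[OF t(1)])
    fix s assume s: "0 \<le> s" "s \<le> t"
    have zd: "((\<lambda>s. z s \<bullet> z s) has_real_derivative 2 * (z s \<bullet> z' s)) (at s)"
    proof -
      have "(z has_derivative (\<lambda>h. h *\<^sub>R z' s)) (at s)"
        using z s t by (auto simp: has_vector_derivative_def)
      from has_derivative_inner[OF this this] show ?thesis
        unfolding has_field_derivative_def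
        by (rule has_derivative_eq_rhs) (auto simp: inner_commute algebra_simps)
    qed
    have "z s \<bullet> z' s \<le> norm (z s) * norm (z' s)" by (rule norm_cauchy_schwarz)
    also have "\<dots> \<le> norm (z s) * (L * norm (z s) + c)"
      using bound s t by (intro mult_left_mono) auto
    finally have "2 * (z s \<bullet> z' s) \<le> 2 * L * (norm (z s))\<^sup>2 + 2 * norm (z s) * c"
      by (simp add: power2_eq_square algebra_simps)
    also have "2 * norm (z s) * c \<le> (norm (z s))\<^sup>2 + c\<^sup>2"
      using sum_squares_bound[of "norm (z s)" c] by simp
    finally have "2 * (z s \<bullet> z' s) \<le> k * (z s \<bullet> z s) + c\<^sup>2"
      by (simp add: k_def dot_square_norm algebra_simps)
    also have "c\<^sup>2 \<le> k * c\<^sup>2" using k mult_right_mono[of 1 k "c\<^sup>2"] by simp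
    finally have le: "2 * (z s \<bullet> z' s) - k * (z s \<bullet> z s + c\<^sup>2) \<le> 0" by (simp add: distrib_left)
    show "\<exists>y. (u has_real_derivative y) (at s) \<and> y \<le> 0"
    proof (intro exI conjI)
      show "(u has_real_derivative (2 * (z s \<bullet> z' s) - k * (z s \<bullet> z s + c\<^sup>2)) * exp (- k * s)) (at s)"
      proof -
        have "((\<lambda>s. z s \<bullet> z s + c\<^sup>2) has_real_derivative 2 * (z s \<bullet> z' s) + 0) (at s)"
          by (intro DERIV_add zd DERIV_const)
        moreover have "((\<lambda>s. exp (- k * s)) has_real_derivative - k * exp (- k * s)) (at s)"
          by (auto intro!: derivative_eq_intros)
        ultimately have "(u has_real_derivative (2 * (z s \<bullet> z' s) + 0) * exp (- k * s)
            + (- k * exp (- k * s)) * (z s \<bullet> z s + c\<^sup>2)) (at s)"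
          unfolding u_def by (rule DERIV_mult)
        moreover have "(p + 0) * e + (- k * e) * r = (p - k * r) * e" for p e r :: real
          by (simp add: algebra_simps)
        ultimately show ?thesis by (simp only:)
      qed
      show "(2 * (z s \<bullet> z' s) - k * (z s \<bullet> z s + c\<^sup>2)) * exp (- k * s) \<le> 0"
        using le by (intro mult_nonpos_nonneg) auto
    qed
  qed
  then have "(z t \<bullet> z t + c\<^sup>2) * exp (- k * t) \<le> c\<^sup>2" by (simp add: u_def z0)
  then have "z t \<bullet> z t + c\<^sup>2 \<le> c\<^sup>2 * exp (k * t)"
    by (simp add: exp_minus divide_inverse[symmetric] pos_divide_le_eq)
  then have "(norm (z t))\<^sup>2 \<le> c\<^sup>2 * exp (k * t)"
    using zero_le_power2[of c] unfolding dot_square_norm by linarith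
  also have "\<dots> \<le> c\<^sup>2 * exp (2 * ((L + 1) * t))"
    using t L by (intro mult_left_mono) (auto simp: k_def algebra_simps)
  also have "\<dots> = (c * exp ((L + 1) * t))\<^sup>2"
    by (simp only: power_mult_distrib exp_double)
  finally show ?thesis
    by (rule power2_le_imp_le) (use c in simp)
qed

section \<open>Continuously differentiable flows and shears\<close>

text \<open>\<open>V\<close> is the generating field and \<open>D t x\<close> the differential of \<open>\<Phi> t\<close> at \<open>x\<close>.\<close>

locale c1_flow =
  fixes \<Phi> :: "real \<Rightarrow> 'a::euclidean_space \<Rightarrow> 'a" and V :: "'a \<Rightarrow> 'a" and D :: "real \<Rightarrow> 'a \<Rightarrow> 'a \<Rightarrow> 'a"
  assumes flow_0: "\<Phi> 0 x = x"
    and flow_add: "\<Phi> (s + t) x = \<Phi> s (\<Phi> t x)"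
    and flow_deriv: "((\<lambda>p. \<Phi> (fst p) (snd p)) has_derivative
          (\<lambda>h. fst h *\<^sub>R V (\<Phi> t x) + D t x (snd h))) (at (t, x))"
    and continuous_field: "continuous_on UNIV V"
    and continuous_D: "continuous_on UNIV (\<lambda>p. D (fst p) (fst (snd p)) (snd (snd p)))"

text \<open>Joint continuity of the differential in point and direction composes like any continuous
  map, without operator norms; on a Euclidean space it amounts to continuous
  differentiability.\<close>

definition c1_map :: "('a::real_normed_vector \<Rightarrow> 'b::real_normed_vector) \<Rightarrow> ('a \<Rightarrow> 'a \<Rightarrow> 'b) \<Rightarrow> bool" where
  "c1_map h D \<longleftrightarrow> (\<forall>x. (h has_derivative D x) (at x)) \<and> continuous_on UNIV (\<lambda>p. D (fst p) (snd p))"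

definition c1_diffeo :: "('a::real_normed_vector \<Rightarrow> 'a) \<Rightarrow> ('a \<Rightarrow> 'a) \<Rightarrow> bool" where
  "c1_diffeo h k \<longleftrightarrow> (\<forall>x. k (h x) = x) \<and> (\<forall>x. h (k x) = x) \<and> (\<exists>D. c1_map h D) \<and> (\<exists>D. c1_map k D)"

lemma c1_diffeo_sym: "c1_diffeo h k \<Longrightarrow> c1_diffeo k h"
  by (auto simp: c1_diffeo_def)

lemma c1_map_continuous: "c1_map h D \<Longrightarrow> continuous_on S h"
  by (meson c1_map_def continuous_at_imp_continuous_on has_derivative_continuous)

lemma c1_map_compose:
  assumes "c1_map f Df" "c1_map g Dg"
  shows "c1_map (\<lambda>x. g (f x)) (\<lambda>x \<xi>. Dg (f x) (Df x \<xi>))"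
  unfolding c1_map_def
proof
  show "\<forall>x. ((\<lambda>x. g (f x)) has_derivative (\<lambda>\<xi>. Dg (f x) (Df x \<xi>))) (at x)"
    using assms by (auto simp: c1_map_def intro: has_derivative_compose)
  have f: "continuous_on UNIV f" using c1_map_continuous assms(1) .
  have "continuous_on UNIV (\<lambda>p. (f (fst p), Df (fst p) (snd p)))"
    using assms(1) by (auto simp: c1_map_def intro!: continuous_intros continuous_on_compose2[OF f])
  from continuous_on_compose2[of UNIV "\<lambda>p. Dg (fst p) (snd p)", OF _ this]
  show "continuous_on UNIV (\<lambda>p. Dg (f (fst p)) (Df (fst p) (snd p)))"
    using assms(2) by (auto simp: c1_map_def)
qed

lemma c1_diffeo_compose:
  assumes "c1_diffeo f f'" "c1_diffeo g g'"
  shows "c1_diffeo (\<lambda>x. g (f x)) (\<lambda>x. f' (g' x))"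
  using assms c1_map_compose unfolding c1_diffeo_def by fastforce

lemma (in c1_flow) continuous_flow: "continuous_on S (\<lambda>p. \<Phi> (fst p) (snd p))"
proof (intro continuous_at_imp_continuous_on ballI)
  fix p :: "real \<times> 'a"
  show "isCont (\<lambda>p. \<Phi> (fst p) (snd p)) p"
    using has_derivative_continuous[OF flow_deriv[of "fst p" "snd p"]] by simp
qed

text \<open>The new field is the push-forward of \<open>V\<close>. For a merely C1 map
  \<open>h\<close> it is only continuous, and \<open>c1_flow\<close> asks no more of a field;
  differentiability is asked of the flow, where the chain rule preserves it.\<close>

lemma (in c1_flow) conjugate:
  assumes "c1_diffeo h k"
  shows "\<exists>V' D'. c1_flow (\<lambda>t x. h (\<Phi> t (k x))) V' D'"
proof -
  obtain Dh Dk where Dh: "c1_map h Dh" and Dk: "c1_map k Dk"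
    and inv: "\<And>x. k (h x) = x" "\<And>x. h (k x) = x"
    using assms by (auto simp: c1_diffeo_def)
  have hd: "(h has_derivative Dh x) (at x)" "(k has_derivative Dk x) (at x)" for x
    using Dh Dk by (auto simp: c1_map_def)
  have contk: "continuous_on UNIV k" using c1_map_continuous Dk .
  have contDh: "continuous_on UNIV (\<lambda>p. Dh (fst p) (snd p))"
    and contDk: "continuous_on UNIV (\<lambda>p. Dk (fst p) (snd p))"
    using Dh Dk by (auto simp: c1_map_def)
  have "c1_flow (\<lambda>t x. h (\<Phi> t (k x))) (\<lambda>y. Dh (k y) (V (k y)))
     (\<lambda>t x \<xi>. Dh (\<Phi> t (k x)) (D t (k x) (Dk x \<xi>)))"
  proof
    show "h (\<Phi> 0 (k x)) = x" for x by (simp add: flow_0 inv)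
    show "h (\<Phi> (s + t) (k x)) = h (\<Phi> s (k (h (\<Phi> t (k x)))))" for s t x
      by (simp add: flow_add inv)
    fix t :: real and x :: 'a
    have 1: "((\<lambda>p. (fst p, k (snd p))) has_derivative (\<lambda>q. (fst q, Dk x (snd q)))) (at (t, x))"
      by (auto intro!: derivative_eq_intros has_derivative_compose[OF _ hd(2)])
    have 2: "((\<lambda>p. \<Phi> (fst p) (k (snd p))) has_derivative
        (\<lambda>q. fst q *\<^sub>R V (\<Phi> t (k x)) + D t (k x) (Dk x (snd q)))) (at (t, x))"
    proof -
      have "((\<lambda>p. \<Phi> (fst p) (snd p)) has_derivative
          (\<lambda>h. fst h *\<^sub>R V (\<Phi> t (k x)) + D t (k x) (snd h))) (at (fst (t, x), k (snd (t, x))))"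
        using flow_deriv[of t "k x"] by simp
      from has_derivative_compose[OF 1 this] show ?thesis by simp
    qed
    have lin: "linear (Dh y)" for y
      using hd(1) has_derivative_linear by blast
    show "((\<lambda>p. h (\<Phi> (fst p) (k (snd p)))) has_derivative
         (\<lambda>ha. fst ha *\<^sub>R Dh (k (h (\<Phi> t (k x)))) (V (k (h (\<Phi> t (k x))))) +
               Dh (\<Phi> t (k x)) (D t (k x) (Dk x (snd ha))))) (at (t, x))"
    proof -
      have "(h has_derivative Dh (\<Phi> t (k x))) (at (\<Phi> (fst (t, x)) (k (snd (t, x)))))"
        by (simp add: hd)
      from has_derivative_compose[OF 2 this] show ?thesis
        by (simp add: inv linear_add[OF lin] linear_cmul[OF lin])
    qed
  next
    have "continuous_on UNIV (\<lambda>y. (k y, V (k y)))"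
      by (intro continuous_on_Pair contk continuous_on_compose2[OF continuous_field contk] subset_UNIV)
    from continuous_on_compose2[OF contDh this] show "continuous_on UNIV (\<lambda>y. Dh (k y) (V (k y)))"
      by simp
    have kx: "continuous_on UNIV (\<lambda>p::real \<times> 'a \<times> 'a. k (fst (snd p)))"
      by (intro continuous_on_compose2[OF contk] continuous_intros subset_UNIV)
    have Dkx: "continuous_on UNIV (\<lambda>p::real \<times> 'a \<times> 'a. Dk (fst (snd p)) (snd (snd p)))"
      using continuous_on_compose2[OF contDk continuous_on_snd[OF continuous_on_id], of UNIV] by simp
    have "continuous_on UNIV (\<lambda>p::real \<times> 'a \<times> 'a. (fst p, k (fst (snd p)), Dk (fst (snd p)) (snd (snd p))))"
      by (intro continuous_on_Pair kx Dkx continuous_intros)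
    from continuous_on_compose2[OF continuous_D this]
    have DD: "continuous_on UNIV (\<lambda>p. D (fst p) (k (fst (snd p))) (Dk (fst (snd p)) (snd (snd p))))"
      by simp
    have "continuous_on UNIV (\<lambda>p::real \<times> 'a \<times> 'a. (fst p, k (fst (snd p))))"
      by (intro continuous_on_Pair kx continuous_intros)
    from continuous_on_compose2[OF continuous_flow[of UNIV] this]
    have "continuous_on UNIV (\<lambda>p::real \<times> 'a \<times> 'a. \<Phi> (fst p) (k (fst (snd p))))" by simp
    from continuous_on_compose2[OF contDh continuous_on_Pair[OF this DD]]
    show "continuous_on UNIV (\<lambda>p. Dh (\<Phi> (fst p) (k (fst (snd p))))
             (D (fst p) (k (fst (snd p))) (Dk (fst (snd p)) (snd (snd p)))))" by simp
  qed
  then show ?thesis by blast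
qed

text \<open>As \<open>F\<close> is orthogonal to \<open>v\<close>, the shear leaves
  \<open>v \<bullet> x\<close> unchanged, so subtracting the same displacement inverts it.\<close>

lemma c1_diffeo_shear:
  fixes v :: "'a::euclidean_space"
  assumes F: "\<And>s. (F has_vector_derivative F' s) (at s)" "continuous_on UNIV F'"
    and perp: "\<And>s. v \<bullet> F s = 0"
  shows "c1_diffeo (\<lambda>x. x + F (v \<bullet> x)) (\<lambda>x. x - F (v \<bullet> x))"
proof -
  have "c1_map (\<lambda>x. x + c *\<^sub>R F (v \<bullet> x)) (\<lambda>x \<xi>. \<xi> + c *\<^sub>R (v \<bullet> \<xi>) *\<^sub>R F' (v \<bullet> x))" for c
    unfolding c1_map_def
  proof (intro conjI allI)
    fix x
    have "((\<lambda>x. F (v \<bullet> x)) has_derivative (\<lambda>\<xi>. (v \<bullet> \<xi>) *\<^sub>R F' (v \<bullet> x))) (at x)"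
      by (rule has_derivative_compose[of "\<lambda>x. v \<bullet> x" "\<lambda>\<xi>. v \<bullet> \<xi>" _ _ F])
        (use F(1) in \<open>auto simp: has_vector_derivative_def intro!: derivative_eq_intros\<close>)
    then show "((\<lambda>x. x + c *\<^sub>R F (v \<bullet> x)) has_derivative (\<lambda>\<xi>. \<xi> + c *\<^sub>R (v \<bullet> \<xi>) *\<^sub>R F' (v \<bullet> x))) (at x)"
      by (auto intro!: derivative_eq_intros)
  qed (intro continuous_intros continuous_on_compose2[OF F(2)] subset_UNIV)
  from this[of 1] this[of "-1"] show ?thesis
    unfolding c1_diffeo_def by (auto simp: inner_add_right inner_diff_right perp)
qed

text \<open>Lagrange interpolation. The values of \<open>F\<close> are linear combinations of the
  \<open>g r\<close>, whence the last clause; it makes the displacement of a shear orthogonal to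
  \<open>v\<close> everywhere.\<close>

lemma interpolating_curve:
  fixes g :: "real \<Rightarrow> 'a::real_inner"
  assumes S: "finite S"
  obtains F F' where "\<And>s. (F has_vector_derivative F' s) (at s)" "continuous_on UNIV F'"
    "\<And>s. s \<in> S \<Longrightarrow> F s = g s" "\<And>v s. (\<And>r. r \<in> S \<Longrightarrow> v \<bullet> g r = 0) \<Longrightarrow> v \<bullet> F s = 0"
proof -
  define l where "l r = smult (1 / (\<Prod>q\<in>S - {r}. r - q)) (\<Prod>q\<in>S - {r}. [:- q, 1:])" for r :: real
  have l: "poly (l r) s = (if r = s then 1 else 0)" if "r \<in> S" "s \<in> S" for r s
  proof (cases "r = s")
    case True
    have "(\<Prod>q\<in>S - {r}. r - q) \<noteq> 0" using S by auto
    then show ?thesis using True by (simp add: l_def poly_prod)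
  next
    case False
    then have "(\<Prod>q\<in>S - {r}. s - q) = 0" using S that by (intro prod_zero) auto
    then show ?thesis using False by (simp add: l_def poly_prod)
  qed
  define F where "F s = (\<Sum>r\<in>S. poly (l r) s *\<^sub>R g r)" for s
  define F' where "F' s = (\<Sum>r\<in>S. poly (pderiv (l r)) s *\<^sub>R g r)" for s
  show ?thesis
  proof
    show "(F has_vector_derivative F' s) (at s)" for s
      unfolding F_def F'_def
      by (intro has_vector_derivative_sum)
        (auto intro!: derivative_eq_intros simp: has_real_derivative_iff_has_vector_derivative[symmetric])
    show "continuous_on UNIV F'" unfolding F'_def by (intro continuous_intros)
    show "F s = g s" if "s \<in> S" for s
    proof -
      have "F s = (\<Sum>r\<in>S. if r = s then g r else 0)"
        unfolding F_def by (rule sum.cong) (auto simp: l that)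
      then show ?thesis using S that by simp
    qed
    show "v \<bullet> F s = 0" if "\<And>r. r \<in> S \<Longrightarrow> v \<bullet> g r = 0" for v s
      using that by (simp add: F_def inner_sum_right)
  qed
qed

lemma shear_interpolation:
  fixes v :: "'a::euclidean_space"
  assumes I: "finite I" and inj: "inj_on (\<lambda>i. v \<bullet> z i) I" and perp: "\<And>i. i \<in> I \<Longrightarrow> v \<bullet> u i = 0"
  obtains h k where "c1_diffeo h k" "\<And>i. i \<in> I \<Longrightarrow> h (z i) = z i + u i"
proof -
  define g where "g s = u (the_inv_into I (\<lambda>i. v \<bullet> z i) s)" for s
  have g: "g (v \<bullet> z i) = u i" if "i \<in> I" for i
    using the_inv_into_f_f[OF inj that] by (simp add: g_def)
  obtain F F' where F: "\<And>s. (F has_vector_derivative F' s) (at s)" "continuous_on UNIV F'"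
    "\<And>s. s \<in> (\<lambda>i. v \<bullet> z i) ` I \<Longrightarrow> F s = g s"
    "\<And>v' s. (\<And>r. r \<in> (\<lambda>i. v \<bullet> z i) ` I \<Longrightarrow> v' \<bullet> g r = 0) \<Longrightarrow> v' \<bullet> F s = 0"
    using interpolating_curve[of "(\<lambda>i. v \<bullet> z i) ` I" g] I by blast
  have "v \<bullet> F s = 0" for s
    by (rule F(4)) (use g perp in auto)
  from c1_diffeo_shear[OF F(1,2) this] F(3) g show ?thesis
    by (intro that) auto
qed

text \<open>Finitely many hyperplanes do not cover the space: \<open>v\<close> is moved along the
  new vector \<open>d\<close>, and each earlier condition rules out at most one coefficient.\<close>

lemma generic_direction:
  fixes S :: "'a::real_inner set"
  assumes "finite S" "0 \<notin> S"
  shows "\<exists>v. \<forall>d\<in>S. v \<bullet> d \<noteq> 0"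
  using assms
proof (induction S)
  case empty
  then show ?case by simp
next
  case (insert d S)
  then obtain v where v: "\<forall>d\<in>S. v \<bullet> d \<noteq> 0" by auto
  show ?case
  proof (cases "v \<bullet> d = 0")
    case False
    with v show ?thesis by blast
  next
    case True
    have "finite ((\<lambda>d'. - (v \<bullet> d') / (d \<bullet> d')) ` S \<union> {0})" using insert by simp
    then obtain c where c: "c \<notin> (\<lambda>d'. - (v \<bullet> d') / (d \<bullet> d')) ` S \<union> {0}"
      using ex_new_if_finite[OF infinite_UNIV_char_0] by blast
    have "(v + c *\<^sub>R d) \<bullet> d' \<noteq> 0" if "d' \<in> S" for d'
    proof
      assume eq: "(v + c *\<^sub>R d) \<bullet> d' = 0"
      have "d \<bullet> d' \<noteq> 0"
        using eq v that by (auto simp: inner_add_left)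
      then have "c = - (v \<bullet> d') / (d \<bullet> d')"
        using eq by (simp add: inner_add_left field_simps)
      then show False using c that by blast
    qed
    moreover have "(v + c *\<^sub>R d) \<bullet> d \<noteq> 0"
      using True c insert.prems by (auto simp: inner_add_left)
    ultimately show ?thesis by blast
  qed
qed

text \<open>Positions on a line serve as a normal form through which any two configurations can be
  connected.\<close>

lemma c1_diffeo_to_line:
  fixes z :: "'i \<Rightarrow> 'a::euclidean_space"
  assumes I: "finite I" and inj: "inj_on z I" and ab: "a \<in> Basis" "b \<in> Basis" "a \<noteq> b"
    and c: "inj_on c I"
  obtains h k where "c1_diffeo h k" "\<And>i. i \<in> I \<Longrightarrow> h (z i) = c i *\<^sub>R a"
proof -
  \<comment> \<open>The differences make \<open>v\<close> separate the points; \<open>b\<close> is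
    included so that \<open>v \<bullet> b \<noteq> 0\<close>, and the vector \<open>w\<close>
    orthogonal to \<open>v\<close> then has a nonzero component along \<open>a\<close>.\<close>
  let ?S = "insert b ((\<lambda>(i, j). z i - z j) ` ({(i, j). i \<in> I \<and> j \<in> I \<and> i \<noteq> j}))"
  have "finite {(i, j). i \<in> I \<and> j \<in> I \<and> i \<noteq> j}"
    by (rule finite_subset[of _ "I \<times> I"]) (use I in auto)
  then have "finite ?S" by simp
  moreover have "0 \<notin> ?S"
  proof -
    have "b \<noteq> 0" using ab(2) nonzero_Basis by blast
    moreover have "z i - z j \<noteq> 0" if "i \<in> I" "j \<in> I" "i \<noteq> j" for i j
      using inj_on_eq_iff[OF inj that(1,2)] that(3) by simp
    ultimately show ?thesis by force
  qed
  ultimately obtain v where v: "\<forall>d\<in>?S. v \<bullet> d \<noteq> 0" using generic_direction by blast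
  have vb: "v \<bullet> b \<noteq> 0" using v by blast
  have "v \<bullet> z i \<noteq> v \<bullet> z j" if "i \<in> I" "j \<in> I" "i \<noteq> j" for i j
  proof -
    have "z i - z j \<in> ?S" using that by force
    with v have "v \<bullet> (z i - z j) \<noteq> 0" by blast
    then show ?thesis by (simp add: inner_diff_right)
  qed
  then have injv: "inj_on (\<lambda>i. v \<bullet> z i) I" by (force simp: inj_on_def)
  \<comment> \<open>A first shear along \<open>w\<close> gives the points distinct \<open>a\<close>-coordinates \<open>c i\<close>; then a shear with
     respect to \<open>a\<close> can change all other coordinates freely.\<close>
  define w where "w = (v \<bullet> b) *\<^sub>R a - (v \<bullet> a) *\<^sub>R b"
  have w: "v \<bullet> w = 0" "a \<bullet> w = v \<bullet> b"
    using ab by (simp_all add: w_def inner_diff_right inner_not_same_Basis mult.commute)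
  obtain h1 k1 where 1: "c1_diffeo h1 k1"
    "\<And>i. i \<in> I \<Longrightarrow> h1 (z i) = z i + ((c i - a \<bullet> z i) / (v \<bullet> b)) *\<^sub>R w"
    by (rule shear_interpolation[OF I injv, of "\<lambda>i. ((c i - a \<bullet> z i) / (v \<bullet> b)) *\<^sub>R w"]) (use w in auto)
  have ah1: "a \<bullet> h1 (z i) = c i" if "i \<in> I" for i
    using 1(2)[OF that] vb by (simp add: inner_add_right w)
  then have "inj_on (\<lambda>i. a \<bullet> h1 (z i)) I" using c by (simp add: inj_on_def)
  then obtain h2 k2 where 2: "c1_diffeo h2 k2"
    "\<And>i. i \<in> I \<Longrightarrow> h2 (h1 (z i)) = h1 (z i) + (c i *\<^sub>R a - h1 (z i))"
    by (rule shear_interpolation[OF I, of a "\<lambda>i. h1 (z i)" "\<lambda>i. c i *\<^sub>R a - h1 (z i)"])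
      (use ab ah1 in \<open>auto simp: inner_diff_right\<close>)
  from that[OF c1_diffeo_compose[OF 1(1) 2(1)]] 2(2) show ?thesis by simp
qed

lemma c1_diffeo_interpolation:
  fixes y z :: "'i \<Rightarrow> 'a::euclidean_space"
  assumes dim: "DIM('a) \<ge> 2" and I: "finite I" and inj: "inj_on y I" "inj_on z I"
  obtains h k where "c1_diffeo h k" "\<And>i. i \<in> I \<Longrightarrow> h (y i) = z i"
proof -
  obtain a b :: 'a where ab: "a \<in> Basis" "b \<in> Basis" "a \<noteq> b"
    using dim by (metis card_2_iff' ex_card subsetD)
  obtain c :: "'i \<Rightarrow> nat" where "inj_on c I"
    using I finite_imp_inj_to_nat_seg by blast
  then have c: "inj_on (\<lambda>i. real (c i)) I" by (simp add: inj_on_def)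
  obtain h k where h: "c1_diffeo h k" "\<And>i. i \<in> I \<Longrightarrow> h (y i) = real (c i) *\<^sub>R a"
    using c1_diffeo_to_line[OF I inj(1) ab c] by blast
  obtain h' k' where h': "c1_diffeo h' k'" "\<And>i. i \<in> I \<Longrightarrow> h' (z i) = real (c i) *\<^sub>R a"
    using c1_diffeo_to_line[OF I inj(2) ab c] by blast
  have "k' (h' (z i)) = z i" for i using h'(1) by (auto simp: c1_diffeo_def)
  then have "k' (h (y i)) = z i" if "i \<in> I" for i
    using h(2)[OF that] h'(2)[OF that] by metis
  with that c1_diffeo_compose[OF h(1) c1_diffeo_sym[OF h'(1)]] show ?thesis by blast
qed

section \<open>Flows realising a permutation\<close>

definition plane_proj :: "'a::real_inner \<Rightarrow> 'a \<Rightarrow> 'a \<Rightarrow> 'a" where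
  "plane_proj a b x = (x \<bullet> a) *\<^sub>R a + (x \<bullet> b) *\<^sub>R b"

definition plane_J :: "'a::real_inner \<Rightarrow> 'a \<Rightarrow> 'a \<Rightarrow> 'a" where
  "plane_J a b x = (x \<bullet> a) *\<^sub>R b - (x \<bullet> b) *\<^sub>R a"

text \<open>For orthonormal \<open>a\<close> and \<open>b\<close> this is the exponential of
  \<theta> times \<open>plane_J\<close>: a rotation of their plane that fixes the orthogonal
  complement.\<close>

definition plane_rot :: "'a::real_inner \<Rightarrow> 'a \<Rightarrow> real \<Rightarrow> 'a \<Rightarrow> 'a" where
  "plane_rot a b \<theta> x = x + (cos \<theta> - 1) *\<^sub>R plane_proj a b x + sin \<theta> *\<^sub>R plane_J a b x"

context
  fixes a b :: "'a::euclidean_space"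
  assumes ab: "a \<in> Basis" "b \<in> Basis" "a \<noteq> b"
begin

lemma plane_inner: "a \<bullet> a = 1" "b \<bullet> b = 1" "a \<bullet> b = 0" "b \<bullet> a = 0"
  using ab by (auto simp: inner_not_same_Basis)

lemma plane_rot_0: "plane_rot a b 0 x = x"
  by (simp add: plane_rot_def)

lemma plane_rot_inner:
  "plane_rot a b \<theta> x \<bullet> a = cos \<theta> * (x \<bullet> a) - sin \<theta> * (x \<bullet> b)"
  "plane_rot a b \<theta> x \<bullet> b = sin \<theta> * (x \<bullet> a) + cos \<theta> * (x \<bullet> b)"
  by (simp_all add: plane_rot_def plane_proj_def plane_J_def inner_add_left inner_diff_left plane_inner algebra_simps)

lemma plane_J_rot: "plane_J a b (plane_rot a b \<theta> x) = cos \<theta> *\<^sub>R plane_J a b x - sin \<theta> *\<^sub>R plane_proj a b x"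
  unfolding plane_J_def plane_rot_inner by (simp add: plane_proj_def algebra_simps)

lemma plane_proj_rot: "plane_proj a b (plane_rot a b \<theta> x) = cos \<theta> *\<^sub>R plane_proj a b x + sin \<theta> *\<^sub>R plane_J a b x"
  unfolding plane_proj_def plane_rot_inner by (simp add: plane_J_def algebra_simps)

lemma plane_rot_add: "plane_rot a b (s + t) x = plane_rot a b s (plane_rot a b t x)"
proof -
  have "plane_rot a b s (plane_rot a b t x) = plane_rot a b t x
      + (cos s - 1) *\<^sub>R (cos t *\<^sub>R plane_proj a b x + sin t *\<^sub>R plane_J a b x)
      + sin s *\<^sub>R (cos t *\<^sub>R plane_J a b x - sin t *\<^sub>R plane_proj a b x)"
    unfolding plane_rot_def[of a b s "plane_rot a b t x"] plane_J_rot plane_proj_rot ..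
  then show ?thesis by (simp add: plane_rot_def cos_add sin_add algebra_simps)
qed

lemma plane_rot_norm: "plane_rot a b \<theta> x \<bullet> plane_rot a b \<theta> x = x \<bullet> x"
proof -
  have c: "(cos \<theta>)\<^sup>2 = 1 - (sin \<theta>)\<^sup>2" by (rule cos_squared_eq)
  define c s u v where "c = cos \<theta>" and "s = sin \<theta>" and "u = x \<bullet> a" and "v = x \<bullet> b"
  have cs: "c * c = 1 - s * s" using c by (simp add: c_def s_def power2_eq_square)
  have rot: "plane_rot a b \<theta> x = x + ((c - 1) * u - s * v) *\<^sub>R a + ((c - 1) * v + s * u) *\<^sub>R b"
    by (simp add: plane_rot_def plane_proj_def plane_J_def c_def s_def u_def v_def algebra_simps)
  have "plane_rot a b \<theta> x \<bullet> plane_rot a b \<theta> x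
      = x \<bullet> x + 2 * ((c - 1) * u - s * v) * u + 2 * ((c - 1) * v + s * u) * v
        + ((c - 1) * u - s * v)\<^sup>2 + ((c - 1) * v + s * u)\<^sup>2"
    unfolding rot
    by (simp add: inner_add_left inner_add_right plane_inner inner_commute[of a x] inner_commute[of b x]
        u_def[symmetric] v_def[symmetric] power2_eq_square algebra_simps)
  also have "\<dots> = x \<bullet> x + (c * c - (1 - s * s)) * (u * u + v * v)"
    by (simp add: power2_eq_square algebra_simps)
  finally show ?thesis by (simp add: cs)
qed

lemma plane_rot_polar:
  "plane_rot a b \<theta> (r *\<^sub>R (cos \<phi> *\<^sub>R a + sin \<phi> *\<^sub>R b)) = r *\<^sub>R (cos (\<phi> + \<theta>) *\<^sub>R a + sin (\<phi> + \<theta>) *\<^sub>R b)"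
  by (simp add: plane_rot_def plane_proj_def plane_J_def inner_add_left plane_inner cos_add sin_add algebra_simps)

text \<open>The rotation preserves \<open>x \<bullet> x\<close>, so the angular speed is constant
  along each orbit and the group law follows from \<open>plane_rot_add\<close>. The squared norm,
  unlike the norm, is differentiable at 0.\<close>

lemma c1_flow_plane_rot:
  fixes \<omega> :: "real \<Rightarrow> real"
  assumes \<omega>: "\<And>s. (\<omega> has_real_derivative \<omega>' s) (at s)" and \<omega>': "continuous_on UNIV \<omega>'"
  shows "\<exists>V D. c1_flow (\<lambda>t x. plane_rot a b (t * \<omega> (x \<bullet> x)) x) V D"
proof -
  let ?P = "plane_proj a b" and ?J = "plane_J a b"
  \<comment> \<open>The last summand comes from differentiating the angle
    \<open>t * \<omega> (x \<bullet> x)\<close> in \<open>x\<close>; its vector is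
    \<open>plane_J\<close> of the rotated point.\<close>
  define D where "D t x \<xi> = \<xi> + (cos (t * \<omega> (x \<bullet> x)) - 1) *\<^sub>R ?P \<xi> + sin (t * \<omega> (x \<bullet> x)) *\<^sub>R ?J \<xi>
     + (t * (\<omega>' (x \<bullet> x) * (2 * (x \<bullet> \<xi>)))) *\<^sub>R (cos (t * \<omega> (x \<bullet> x)) *\<^sub>R ?J x - sin (t * \<omega> (x \<bullet> x)) *\<^sub>R ?P x)" for t x \<xi>
  have c\<omega>: "continuous_on UNIV \<omega>"
    by (intro continuous_at_imp_continuous_on ballI DERIV_isCont[OF \<omega>])
  note cs = continuous_on_compose2[OF c\<omega>] continuous_on_compose2[OF \<omega>']
  have "c1_flow (\<lambda>t x. plane_rot a b (t * \<omega> (x \<bullet> x)) x) (\<lambda>x. \<omega> (x \<bullet> x) *\<^sub>R ?J x) D"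
  proof
    show "plane_rot a b (0 * \<omega> (x \<bullet> x)) x = x" for x by (simp add: plane_rot_0)
    show "plane_rot a b ((s + t) * \<omega> (x \<bullet> x)) x = plane_rot a b
        (s * \<omega> (plane_rot a b (t * \<omega> (x \<bullet> x)) x \<bullet> plane_rot a b (t * \<omega> (x \<bullet> x)) x))
        (plane_rot a b (t * \<omega> (x \<bullet> x)) x)" for s t x
      by (simp add: plane_rot_norm distrib_right plane_rot_add)
    show "continuous_on UNIV (\<lambda>x. \<omega> (x \<bullet> x) *\<^sub>R ?J x)"
      unfolding plane_J_def by (intro continuous_intros cs subset_UNIV)
    show "continuous_on UNIV (\<lambda>p. D (fst p) (fst (snd p)) (snd (snd p)))"
      unfolding D_def plane_J_def plane_proj_def by (intro continuous_intros cs subset_UNIV)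
    fix t x
    define \<theta> where "\<theta> p = fst p * \<omega> (snd p \<bullet> snd p)" for p :: "real \<times> 'a"
    define \<theta>' where "\<theta>' h = fst h * \<omega> (x \<bullet> x) + t * (\<omega>' (x \<bullet> x) * (2 * (x \<bullet> snd h)))" for h :: "real \<times> 'a"
    have n: "((\<lambda>p. snd p \<bullet> snd p) has_derivative (\<lambda>h. 2 * (x \<bullet> snd h))) (at (t, x))"
      by (auto intro!: derivative_eq_intros simp: inner_commute)
    have "(\<omega> has_derivative (\<lambda>h. \<omega>' (x \<bullet> x) * h)) (at (snd (t, x) \<bullet> snd (t, x)))"
      using \<omega> by (simp add: has_field_derivative_def)
    from has_derivative_compose[OF n this]
    have "((\<lambda>p. \<omega> (snd p \<bullet> snd p)) has_derivative (\<lambda>h. \<omega>' (x \<bullet> x) * (2 * (x \<bullet> snd h)))) (at (t, x))" .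
    then have \<theta>: "(\<theta> has_derivative \<theta>') (at (t, x))"
      unfolding \<theta>_def \<theta>'_def by (auto intro!: derivative_eq_intros simp: add.commute)
    have P: "((\<lambda>p. ?P (snd p)) has_derivative (\<lambda>h. ?P (snd h))) (at (t, x))"
      and J: "((\<lambda>p. ?J (snd p)) has_derivative (\<lambda>h. ?J (snd h))) (at (t, x))"
      unfolding plane_proj_def plane_J_def by (auto intro!: derivative_eq_intros)
    have "((\<lambda>p. snd p + (cos (\<theta> p) - 1) *\<^sub>R ?P (snd p) + sin (\<theta> p) *\<^sub>R ?J (snd p)) has_derivative
        (\<lambda>h. snd h + ((cos (\<theta> (t, x)) - 1) *\<^sub>R ?P (snd h) + (- sin (\<theta> (t, x)) * \<theta>' h) *\<^sub>R ?P x)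
           + (sin (\<theta> (t, x)) *\<^sub>R ?J (snd h) + (cos (\<theta> (t, x)) * \<theta>' h) *\<^sub>R ?J x))) (at (t, x))"
      by (auto intro!: derivative_eq_intros \<theta> P J simp: mult.commute)
    then show "((\<lambda>p. plane_rot a b (fst p * \<omega> (snd p \<bullet> snd p)) (snd p)) has_derivative
        (\<lambda>h. fst h *\<^sub>R \<omega> (plane_rot a b (t * \<omega> (x \<bullet> x)) x \<bullet> plane_rot a b (t * \<omega> (x \<bullet> x)) x) *\<^sub>R
             ?J (plane_rot a b (t * \<omega> (x \<bullet> x)) x) + D t x (snd h))) (at (t, x))"
      unfolding plane_rot_norm plane_J_rot plane_rot_def[of a b _ "snd _"] \<theta>_def[symmetric]
      by (rule has_derivative_eq_rhs)
        (auto simp: fun_eq_iff D_def \<theta>_def \<theta>'_def algebra_simps)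
  qed
  then show ?thesis by blast
qed

end

text \<open>Coordinates along the cycles: \<open>r\<close> numbers the cycle, \<open>len\<close> is
  its length, and \<open>d\<close> counts steps from a base point, which is meaningful only modulo
  \<open>len\<close>.\<close>

lemma permutation_orbit_labels:
  fixes \<sigma> :: "'a \<Rightarrow> 'a"
  assumes Z: "finite Z" and \<sigma>: "\<sigma> permutes Z"
  obtains r len d :: "'a \<Rightarrow> nat" where
    "\<And>z. len z > 0" "\<And>z. r (\<sigma> z) = r z" "\<And>z. len (\<sigma> z) = len z"
    "\<And>z. d (\<sigma> z) mod len z = Suc (d z) mod len z"
    "\<And>z z'. \<lbrakk>z \<in> Z; z' \<in> Z; r z = r z'\<rbrakk> \<Longrightarrow> len z = len z'"
    "\<And>z z'. \<lbrakk>z \<in> Z; z' \<in> Z; r z = r z'; d z mod len z = d z' mod len z\<rbrakk> \<Longrightarrow> z = z'"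
proof -
  have perm: "permutation \<sigma>" using Z \<sigma> by (auto simp: permutation_permutes)
  then have inj: "inj \<sigma>" by (simp add: permutation bij_is_inj)
  define orb where "orb z = orbit \<sigma> z" for z
  have orb_eq: "orb y = orb z" if "y \<in> orb z" for y z
    using orbit_cyclic_eq3[OF cyclic_on_orbit'[OF perm]] that by (simp add: orb_def)
  have self: "z \<in> orb z" for z
    using permutation_self_in_orbit[OF perm] by (simp add: orb_def)
  have orb_step: "orb (\<sigma> z) = orb z" for z
    by (rule orb_eq) (simp add: orb_def orbit.base)
  \<comment> \<open>The base point is chosen from the orbit as a set, hence is the same for all
    points of a cycle.\<close>
  define c where "c z = (SOME y. y \<in> orb z)" for z
  have c_step: "c (\<sigma> z) = c z" for z by (simp add: c_def orb_step)
  have c_orb: "orb (c z) = orb z" for z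
    unfolding c_def by (rule orb_eq) (rule someI, rule self)
  have "\<exists>n. (\<sigma> ^^ n) (c z) = z" for z
  proof -
    have "z \<in> orbit \<sigma> (c z)" using c_orb[of z] self[of z] by (simp add: orb_def)
    then obtain n where "z = (\<sigma> ^^ n) (c z)" unfolding orbit_altdef by blast
    then show ?thesis by (intro exI[of _ n]) (rule sym)
  qed
  then obtain d where d: "\<And>z. (\<sigma> ^^ d z) (c z) = z" by metis
  define len where "len z = least_power \<sigma> (c z)" for z
  have len: "len z > 0" for z using least_power_of_permutation[OF perm] by (simp add: len_def)
  have le: "m mod len z = n mod len z"
    if "m \<le> n" "(\<sigma> ^^ m) (c z) = (\<sigma> ^^ n) (c z)" for m n z
  proof -
    have "(\<sigma> ^^ (n - m)) (c z) = c z" using funpow_diff[OF inj that] .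
    then have "len z dvd n - m" by (simp add: len_def least_power_minimal)
    then show ?thesis using that(1) by (metis mod_eq_dvd_iff_nat)
  qed
  have mod_eq: "m mod len z = n mod len z" if "(\<sigma> ^^ m) (c z) = (\<sigma> ^^ n) (c z)" for m n z
  proof (cases "m \<le> n")
    case True
    then show ?thesis using that by (rule le)
  next
    case False
    then have "n \<le> m" by simp
    then show ?thesis by (rule le[OF _ that[symmetric], symmetric])
  qed
  have funpow_eq: "(\<sigma> ^^ m) (c z) = (\<sigma> ^^ n) (c z)" if "m mod len z = n mod len z" for m n z
  proof -
    have *: "(\<sigma> ^^ (j mod len z)) (c z) = (\<sigma> ^^ j) (c z)" for j
      by (rule funpow_mod_eq) (simp add: len_def least_power_of_permutation(1)[OF perm])
    show ?thesis using *[of m] *[of n] that by simp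
  qed
  obtain f :: "'a set \<Rightarrow> nat" where f: "inj_on f (orb ` Z)"
    using finite_imp_inj_to_nat_seg[of "orb ` Z"] Z by auto
  have same: "c z = c z'" if "z \<in> Z" "z' \<in> Z" "f (orb z) = f (orb z')" for z z'
    using inj_onD[OF f that(3)] that by (simp add: c_def)
  show ?thesis
  proof (rule that[of len "\<lambda>z. f (orb z)" d])
    show "d (\<sigma> z) mod len z = Suc (d z) mod len z" for z
      using d[of "\<sigma> z"] d[of z] by (intro mod_eq) (simp add: c_step)
    show "len z = len z'" if "z \<in> Z" "z' \<in> Z" "f (orb z) = f (orb z')" for z z'
      using same[OF that] by (simp add: len_def)
    show "z = z'" if "z \<in> Z" "z' \<in> Z" "f (orb z) = f (orb z')" "d z mod len z = d z' mod len z" for z z'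
      using funpow_eq[OF that(4)] same[OF that(1-3)] d by metis
    show "len (\<sigma> z) = len z" for z by (simp add: len_def c_step)
  qed (simp_all add: len orb_step)
qed

lemma cyclic_model_flow:
  fixes \<sigma> :: "'i \<Rightarrow> 'i"
  assumes dim: "DIM('a::euclidean_space) \<ge> 2" and Z: "finite Z" and \<sigma>: "\<sigma> permutes Z" and T: "T > 0"
  obtains \<Phi> V D and p :: "'i \<Rightarrow> 'a::euclidean_space" where "c1_flow \<Phi> V D" "\<And>z. z \<in> Z \<Longrightarrow> \<Phi> T (p z) = p (\<sigma> z)"
    "\<And>z z' t. \<lbrakk>z \<in> Z; z' \<in> Z; 0 \<le> t; t \<le> T; \<Phi> t (p z') = \<Phi> (T / 2) (p z)\<rbrakk> \<Longrightarrow> z' = z \<and> t = T / 2"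
proof -
  obtain a b :: 'a where ab: "a \<in> Basis" "b \<in> Basis" "a \<noteq> b"
    using dim by (metis card_2_iff' ex_card subsetD)
  obtain r len d :: "'i \<Rightarrow> nat" where len: "\<And>z. len z > 0"
    and step: "\<And>z. r (\<sigma> z) = r z" "\<And>z. len (\<sigma> z) = len z" "\<And>z. d (\<sigma> z) mod len z = Suc (d z) mod len z"
    and sep: "\<And>z z'. \<lbrakk>z \<in> Z; z' \<in> Z; r z = r z'\<rbrakk> \<Longrightarrow> len z = len z'"
    "\<And>z z'. \<lbrakk>z \<in> Z; z' \<in> Z; r z = r z'; d z mod len z = d z' mod len z\<rbrakk> \<Longrightarrow> z = z'"
    by (rule permutation_orbit_labels[OF Z \<sigma>]) (rule that)
  \<comment> \<open>Distinct cycles get distinct radii; the 1 keeps the circle with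
    \<open>r z = 0\<close> from degenerating.\<close>
  define \<rho> where "\<rho> z = real (r z) + 1" for z
  have \<rho>: "\<rho> z > 0" "\<rho> z = \<rho> z' \<longleftrightarrow> r z = r z'" for z z' by (simp_all add: \<rho>_def add_nonneg_pos)
  define \<phi> where "\<phi> z = 2 * pi * (real (d z) / real (len z))" for z
  define e where "e \<theta> = cos \<theta> *\<^sub>R a + sin \<theta> *\<^sub>R b" for \<theta>
  define p where "p z = \<rho> z *\<^sub>R e (\<phi> z)" for z
  have ip: "a \<bullet> a = 1" "b \<bullet> b = 1" "a \<bullet> b = 0" "b \<bullet> a = 0"
    using ab by (auto simp: inner_not_same_Basis)
  have ee: "e \<theta> \<bullet> e \<theta> = 1" "e \<theta> \<bullet> a = cos \<theta>" "e \<theta> \<bullet> b = sin \<theta>" for \<theta>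
    by (simp_all add: e_def inner_add_left inner_add_right ip power2_eq_square[symmetric])
  \<comment> \<open>The angular speed that makes 1 / len of a turn in time \<open>T\<close>, as a
    function of the squared radius. Points of \<open>Z\<close> with equal radii have equal
    \<open>len\<close>, so the choice does not matter.\<close>
  define g where "g s = 2 * pi / (real (len (SOME z. z \<in> Z \<and> (\<rho> z)\<^sup>2 = s)) * T)" for s
  have g: "g ((\<rho> z)\<^sup>2) = 2 * pi / (real (len z) * T)" if "z \<in> Z" for z
  proof -
    define z' where "z' = (SOME z'. z' \<in> Z \<and> (\<rho> z')\<^sup>2 = (\<rho> z)\<^sup>2)"
    have "z' \<in> Z \<and> (\<rho> z')\<^sup>2 = (\<rho> z)\<^sup>2"
      unfolding z'_def by (rule someI[of _ z]) (simp add: that)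
    moreover from this have "\<rho> z' = \<rho> z" using \<rho>(1) by (meson less_imp_le power2_eq_imp_eq)
    ultimately have "len z' = len z" using sep(1) that \<rho>(2) by blast
    then show ?thesis by (simp add: g_def z'_def)
  qed
  obtain \<omega> \<omega>' where \<omega>: "\<And>s. (\<omega> has_vector_derivative \<omega>' s) (at s)" "continuous_on UNIV \<omega>'"
    "\<And>s. s \<in> (\<lambda>z. (\<rho> z)\<^sup>2) ` Z \<Longrightarrow> \<omega> s = g s"
    by (rule interpolating_curve[of "(\<lambda>z. (\<rho> z)\<^sup>2) ` Z" g]) (use Z in auto)
  define \<Phi> where "\<Phi> t x = plane_rot a b (t * \<omega> (x \<bullet> x)) x" for t x
  obtain V D where flow: "c1_flow \<Phi> V D"
    using c1_flow_plane_rot[OF ab, of \<omega> \<omega>'] \<omega>(1,2)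
    unfolding has_real_derivative_iff_has_vector_derivative \<Phi>_def by blast
  have \<Phi>p: "\<Phi> t (p z) = \<rho> z *\<^sub>R e (2 * pi * ((real (d z) + t / T) / real (len z)))" if "z \<in> Z" for t z
  proof -
    have "p z \<bullet> p z = (\<rho> z)\<^sup>2" by (simp add: p_def ee power2_eq_square)
    then have "\<omega> (p z \<bullet> p z) = 2 * pi / (real (len z) * T)" using \<omega>(3) g that by simp
    then have "\<Phi> t (p z) = \<rho> z *\<^sub>R e (\<phi> z + t * (2 * pi / (real (len z) * T)))"
      unfolding \<Phi>_def p_def e_def by (simp add: plane_rot_polar[OF ab])
    moreover have "\<phi> z + t * (2 * pi / (real (len z) * T)) = 2 * pi * ((real (d z) + t / T) / real (len z))"
      using T len[of z] by (simp add: \<phi>_def field_simps)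
    ultimately show ?thesis by simp
  qed
  have e_mod: "e (2 * pi * (real m / real l)) = e (2 * pi * (real n / real l))"
    if "m mod l = n mod l" "l > 0" for m n l :: nat
  proof -
    have "int l dvd int m - int n"
      using that by (metis mod_eq_dvd_iff of_nat_mod)
    then obtain k where "int m - int n = int l * k" by blast
    then have "real_of_int (int m - int n) = real_of_int (int l * k)" by (rule arg_cong)
    then have "real m / real l = real n / real l + real_of_int k"
      using that(2) by (simp add: field_simps)
    then have eq: "2 * pi * (real m / real l) = 2 * pi * (real n / real l) + 2 * pi * real_of_int k"
      by (simp only: distrib_left)
    show ?thesis
      unfolding e_def using sin_cos_eq_iff[of "2 * pi * (real m / real l)" "2 * pi * (real n / real l)"] eq by auto
  qed
  show ?thesis
  proof (rule that[OF flow])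
    show "\<Phi> T (p z) = p (\<sigma> z)" if "z \<in> Z" for z
    proof -
      have "\<rho> (\<sigma> z) = \<rho> z" by (simp add: \<rho>_def step)
      moreover have "\<Phi> T (p z) = \<rho> z *\<^sub>R e (2 * pi * (real (Suc (d z)) / real (len z)))"
        using \<Phi>p[OF that, of T] T by (simp add: add.commute)
      moreover have "p (\<sigma> z) = \<rho> (\<sigma> z) *\<^sub>R e (2 * pi * (real (d (\<sigma> z)) / real (len z)))"
        by (simp add: p_def \<phi>_def step)
      ultimately show ?thesis using e_mod[OF step(3) len, of z] by simp
    qed
    fix z z' t
    assume z: "z \<in> Z" "z' \<in> Z" and t: "0 \<le> t" "t \<le> T" and eq: "\<Phi> t (p z') = \<Phi> (T / 2) (p z)"
    define \<alpha> \<alpha>' where "\<alpha> = 2 * pi * ((real (d z) + 1 / 2) / real (len z))"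
      and "\<alpha>' = 2 * pi * ((real (d z') + t / T) / real (len z'))"
    have eq': "\<rho> z' *\<^sub>R e \<alpha>' = \<rho> z *\<^sub>R e \<alpha>"
      using eq \<Phi>p[OF z(1), of "T / 2"] \<Phi>p[OF z(2), of t] T by (simp add: \<alpha>_def \<alpha>'_def)
    then have "(\<rho> z' *\<^sub>R e \<alpha>') \<bullet> (\<rho> z' *\<^sub>R e \<alpha>') = (\<rho> z *\<^sub>R e \<alpha>) \<bullet> (\<rho> z *\<^sub>R e \<alpha>)" by simp
    then have "(\<rho> z')\<^sup>2 = (\<rho> z)\<^sup>2" by (simp add: ee power2_eq_square)
    then have \<rho>eq: "\<rho> z' = \<rho> z" using \<rho>(1) by (meson less_imp_le power2_eq_imp_eq)
    then have req: "r z = r z'" using \<rho>(2) by metis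
    then have leneq: "len z' = len z" using sep(1) z by metis
    have "\<rho> z \<noteq> 0" using \<rho>(1)[of z] by simp
    then have "e \<alpha>' = e \<alpha>" using eq' \<rho>eq by simp
    then have "sin \<alpha>' = sin \<alpha> \<and> cos \<alpha>' = cos \<alpha>" using ee(2,3) by metis
    then obtain n :: int where n: "\<alpha>' = \<alpha> + 2 * pi * real_of_int n"
      using sin_cos_eq_iff by blast
    then have "2 * pi * ((real (d z') + t / T) / real (len z)) = 2 * pi * ((real (d z) + 1 / 2) / real (len z) + real_of_int n)"
      by (simp add: \<alpha>_def \<alpha>'_def leneq distrib_left)
    then have quot: "(real (d z') + t / T) / real (len z) = (real (d z) + 1 / 2) / real (len z) + real_of_int n"
      unfolding mult_cancel_left by simp
    then have main: "real (d z') + t / T = real (d z) + 1 / 2 + real_of_int n * real (len z)"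
    proof -
      have "A = B + n * l" if "A / l = B / l + n" "l > 0" for A B n l :: real
        using that by (simp add: divide_eq_eq distrib_right)
      from this[OF quot] show ?thesis using len[of z] by simp
    qed
    \<comment> \<open>In units of one step along the cycle, arcs start at integers and midpoints are
      half-integers. So \<open>t / T - 1 / 2\<close> is an integer between -1/2 and 1/2, which
      leaves only 0.\<close>
    define k where "k = int (d z) - int (d z') + n * int (len z)"
    have k: "real_of_int k = t / T - 1 / 2" using main by (simp add: k_def)
    have "0 \<le> t / T" "t / T \<le> 1" using t T by auto
    then have "k = 0" using k by linarith
    then have "t / T = 1 / 2" using k by simp
    then have t2: "t = T / 2" using T by (simp add: field_simps)
    have "int (d z') = int (d z) + n * int (len z)" using \<open>k = 0\<close> by (simp add: k_def)
    then have "int (d z') mod int (len z) = int (d z) mod int (len z)" by simp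
    then have "d z mod len z = d z' mod len z" by (metis of_nat_eq_iff of_nat_mod)
    then have "z = z'" using sep(2)[OF z req] by blast
    with t2 show "z' = z \<and> t = T / 2" by simp
  qed
qed

text \<open>The diffeomorphism \<open>h\<close> with \<open>h (p z) = z\<close> is injective, so
  conjugating the model flow by it preserves the separation of the arcs.\<close>

lemma permutation_flow:
  fixes \<sigma> :: "'a::euclidean_space \<Rightarrow> 'a"
  assumes dim: "DIM('a) \<ge> 2" and Z: "finite Z" and \<sigma>: "\<sigma> permutes Z" and T: "T > 0"
  obtains \<Phi> V D where "c1_flow \<Phi> V D" "\<And>z. z \<in> Z \<Longrightarrow> \<Phi> T z = \<sigma> z"
    "\<And>z z' t. \<lbrakk>z \<in> Z; z' \<in> Z; 0 \<le> t; t \<le> T; \<Phi> t z' = \<Phi> (T / 2) z\<rbrakk> \<Longrightarrow> z' = z \<and> t = T / 2"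
proof -
  obtain \<Phi> V D and p :: "'a \<Rightarrow> 'a" where flow: "c1_flow \<Phi> V D" and step: "\<And>z. z \<in> Z \<Longrightarrow> \<Phi> T (p z) = p (\<sigma> z)"
    and sep: "\<And>z z' t. \<lbrakk>z \<in> Z; z' \<in> Z; 0 \<le> t; t \<le> T; \<Phi> t (p z') = \<Phi> (T / 2) (p z)\<rbrakk> \<Longrightarrow> z' = z \<and> t = T / 2"
    by (rule cyclic_model_flow[where ?'a = 'a, OF dim Z \<sigma> T]) (rule that)
  \<comment> \<open>Equal positions would flow to equal midpoints, which separation at
    \<open>t = T / 2\<close> excludes.\<close>
  have "inj_on p Z"
  proof (rule inj_onI)
    fix z z' assume "z \<in> Z" "z' \<in> Z" "p z = p z'"
    then show "z = z'" using sep[of z z' "T / 2"] T by simp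
  qed
  then obtain h k where hk: "c1_diffeo h k" and h: "\<And>z. z \<in> Z \<Longrightarrow> h (p z) = z"
    by (rule c1_diffeo_interpolation[OF dim Z, of p "\<lambda>z. z"]) simp_all
  have kh: "k (h x) = x" for x using hk by (simp add: c1_diffeo_def)
  have k: "k z = p z" if "z \<in> Z" for z using h[OF that] kh[of "p z"] by simp
  obtain V' D' where "c1_flow (\<lambda>t x. h (\<Phi> t (k x))) V' D'"
    using c1_flow.conjugate[OF flow hk] by blast
  then show ?thesis
  proof (rule that)
    show "h (\<Phi> T (k z)) = \<sigma> z" if "z \<in> Z" for z
      using k[OF that] step[OF that] h permutes_in_image[OF \<sigma>] that by simp
    show "z' = z \<and> t = T / 2"
      if "z \<in> Z" "z' \<in> Z" "0 \<le> t" "t \<le> T" "h (\<Phi> t (k z')) = h (\<Phi> (T / 2) (k z))" for z z' t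
      using that(5) sep[OF that(1-4)] k that(1,2) kh by metis
  qed
qed

text \<open>There are as many inputs as targets, so the targets that are not inputs match in number
  the inputs that are not targets. Any bijection from the former to the latter closes the remaining
  chains to cycles.\<close>

lemma extend_to_permutation:
  assumes "finite I" "inj_on x I" "inj_on y I"
  obtains Z \<sigma> where "finite Z" "\<sigma> permutes Z" "x ` I \<subseteq> Z" "\<And>i. i \<in> I \<Longrightarrow> \<sigma> (x i) = y i"
proof -
  define X Y where "X = x ` I" and "Y = y ` I"
  have fin: "finite X" "finite Y" using assms by (auto simp: X_def Y_def)
  have "card X = card Y" using assms by (simp add: X_def Y_def card_image)
  then have "card ((X \<union> Y) - X) = card ((X \<union> Y) - Y)"
    using fin by (simp add: card_Diff_subset)
  then obtain f where f: "bij_betw f ((X \<union> Y) - X) ((X \<union> Y) - Y)"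
    using fin by (metis finite_Diff finite_UnI finite_same_card_bij)
  define g where "g z = (if z \<in> X then y (the_inv_into I x z) else f z)" for z
  have gx: "g (x i) = y i" if "i \<in> I" for i
    using that assms(2) by (simp add: g_def X_def the_inv_into_f_f)
  have 1: "bij_betw g X Y"
    unfolding bij_betw_def
  proof
    show "inj_on g X" using gx assms(3) by (auto simp: X_def inj_on_def)
    show "g ` X = Y" using gx by (force simp: X_def Y_def)
  qed
  have 2: "bij_betw g ((X \<union> Y) - X) ((X \<union> Y) - Y)"
    using f by (rule bij_betw_cong[THEN iffD1, rotated]) (simp add: g_def)
  have "bij_betw g (X \<union> ((X \<union> Y) - X)) (Y \<union> ((X \<union> Y) - Y))"
    by (rule bij_betw_combine[OF 1 2]) auto
  moreover have "X \<union> ((X \<union> Y) - X) = X \<union> Y" "Y \<union> ((X \<union> Y) - Y) = X \<union> Y" by auto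
  ultimately have "bij_betw g (X \<union> Y) (X \<union> Y)" by simp
  then have "bij_betw (\<lambda>z. if z \<in> X \<union> Y then g z else z) (X \<union> Y) (X \<union> Y)"
    by (rule bij_betw_cong[THEN iffD1, rotated]) simp
  then have "(\<lambda>z. if z \<in> X \<union> Y then g z else z) permutes (X \<union> Y)"
    by (rule bij_imp_permutes) simp
  then show ?thesis
    by (rule that[rotated]) (use fin gx in \<open>auto simp: X_def\<close>)
qed

section \<open>Perturbation of a flow along finitely many arcs\<close>

context c1_flow
begin

lemma has_derivative_flow: "(\<Phi> t has_derivative D t x) (at x)"
proof -
  have "((\<lambda>y. (t, y)) has_derivative (\<lambda>\<xi>. (0, \<xi>))) (at x)"
    by (auto intro!: derivative_eq_intros)
  from has_derivative_compose[OF this flow_deriv[of t x]] show ?thesis by simp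
qed

lemma linear_D: "linear (D t x)"
  using has_derivative_flow has_derivative_linear by blast

lemma has_vector_derivative_flow: "((\<lambda>s. \<Phi> s x) has_vector_derivative V (\<Phi> t x)) (at t)"
proof -
  have "((\<lambda>s. (s, x)) has_derivative (\<lambda>h. (h, 0))) (at t)"
    by (auto intro!: derivative_eq_intros)
  from has_derivative_compose[OF this flow_deriv[of t x]] show ?thesis
    by (simp add: has_vector_derivative_def linear_0[OF linear_D])
qed

lemma D_compose: "D s (\<Phi> t x) (D t x \<xi>) = D (s + t) x \<xi>"
proof -
  have "((\<lambda>y. \<Phi> s (\<Phi> t y)) has_derivative (\<lambda>\<xi>. D s (\<Phi> t x) (D t x \<xi>))) (at x)"
    by (rule has_derivative_compose[OF has_derivative_flow has_derivative_flow])
  moreover have "((\<lambda>y. \<Phi> s (\<Phi> t y)) has_derivative D (s + t) x) (at x)"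
    using has_derivative_flow[of "s + t" x] by (simp add: flow_add[abs_def])
  ultimately have "(\<lambda>\<xi>. D s (\<Phi> t x) (D t x \<xi>)) = D (s + t) x"
    by (rule has_derivative_unique)
  then show ?thesis by (rule fun_cong)
qed

lemma D_0: "D 0 x \<xi> = \<xi>"
proof -
  have "(\<Phi> 0) = (\<lambda>x. x)" by (rule ext) (rule flow_0)
  then have "((\<lambda>x. x) has_derivative D 0 x) (at x)" using has_derivative_flow[of 0 x] by simp
  then have "D 0 x = (\<lambda>\<xi>. \<xi>)" by (rule has_derivative_unique) (rule has_derivative_ident)
  then show ?thesis by simp
qed

lemma flow_minus: "\<Phi> (- t) (\<Phi> t x) = x" "\<Phi> t (\<Phi> (- t) x) = x"
  by (simp_all add: flow_add[symmetric] flow_0)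

text \<open>Both sides are the derivative of \<open>\<Phi> t (\<Phi> s x)\<close> in
  \<open>s\<close> at 0, once by the chain rule and once by the group law.\<close>

lemma D_field: "D t x (V x) = V (\<Phi> t x)"
proof -
  have "((\<lambda>s. \<Phi> s x) has_derivative (\<lambda>h. h *\<^sub>R V x)) (at 0)"
    using has_vector_derivative_flow[of x 0] by (simp add: has_vector_derivative_def flow_0)
  from has_derivative_compose[OF this, of "\<Phi> t" "D t x"]
  have "((\<lambda>s. \<Phi> t (\<Phi> s x)) has_vector_derivative D t x (V x)) (at 0)"
    using has_derivative_flow by (simp add: has_vector_derivative_def flow_0 linear_cmul[OF linear_D])
  moreover have "((\<lambda>s. \<Phi> t (\<Phi> s x)) has_vector_derivative V (\<Phi> t x)) (at 0)"
    using has_vector_derivative_flow[of "\<Phi> t x" 0]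
    by (simp add: flow_add[symmetric] flow_0 add.commute)
  ultimately show ?thesis by (rule vector_derivative_unique_at)
qed

text \<open>Variation of constants: the backward flow removes the motion along \<open>V\<close>,
  which by \<open>D_field\<close> leaves the deviation \<open>w - V (X t)\<close>, transported to
  time 0.\<close>

lemma has_vector_derivative_pullback:
  assumes "(X has_vector_derivative w) (at t)"
  shows "((\<lambda>s. \<Phi> (- s) (X s)) has_vector_derivative D (- t) (X t) (w - V (X t))) (at t)"
proof -
  have "((\<lambda>s. (- s, X s)) has_derivative (\<lambda>h. (- h, h *\<^sub>R w))) (at t)"
    using assms by (auto simp: has_vector_derivative_def intro!: derivative_eq_intros)
  from has_derivative_compose[OF this flow_deriv[of "- t" "X t"]] show ?thesis
    by (simp add: has_vector_derivative_def linear_diff[OF linear_D] linear_cmul[OF linear_D] D_field algebra_simps)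
qed

end

section \<open>Estimates for curves from bounds on their derivatives\<close>

lemma norm_diff_le_of_deriv_bound:
  fixes g :: "real \<Rightarrow> 'a::real_normed_vector"
  assumes ab: "a \<le> b" and g: "\<And>t. a \<le> t \<Longrightarrow> t \<le> b \<Longrightarrow> (g has_vector_derivative g' t) (at t)"
    and h: "\<And>t. a \<le> t \<Longrightarrow> t \<le> b \<Longrightarrow> (h has_vector_derivative h' t) (at t)"
    and bound: "\<And>t. a < t \<Longrightarrow> t < b \<Longrightarrow> norm (g' t) \<le> h' t"
  shows "norm (g b - g a) \<le> h b - h a"
proof (cases "a = b")
  case False
  show ?thesis
  proof (rule differentiable_bound_general[where f' = g' and \<phi>' = h'])
    show "continuous_on {a..b} g"
      by (intro continuous_at_imp_continuous_on ballI has_vector_derivative_continuous[OF g]) auto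
    show "continuous_on {a..b} h"
      by (intro continuous_at_imp_continuous_on ballI has_vector_derivative_continuous[OF h]) auto
  qed (use ab False g h bound in auto)
qed simp

text \<open>A first-exit argument: the derivative bound is known only inside the ball, but up to the
  first time at distance \<open>r\<close> the curve moves by at most
  \<open>c * T < r\<close>.\<close>

lemma confined_of_deriv_bound:
  fixes q :: "real \<Rightarrow> 'a::real_normed_vector"
  assumes q: "\<And>t. 0 \<le> t \<Longrightarrow> t \<le> T \<Longrightarrow> (q has_vector_derivative q' t) (at t)"
    and bound: "\<And>t. 0 \<le> t \<Longrightarrow> t \<le> T \<Longrightarrow> norm (q t - q 0) \<le> r \<Longrightarrow> norm (q' t) \<le> c"
    and c: "0 \<le> c" "c * T < r" and t: "0 \<le> t" "t \<le> T"
  shows "norm (q t - q 0) < r"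
proof (rule ccontr)
  have T: "0 \<le> T" using t by simp
  have r: "r > 0" using c T by (meson le_less_trans mult_nonneg_nonneg)
  define S where "S = {t \<in> {0..T}. r \<le> norm (q t - q 0)}"
  assume "\<not> norm (q t - q 0) < r"
  then have "S \<noteq> {}" using t by (auto simp: S_def)
  have contq: "continuous_on {0..T} q"
    by (intro continuous_at_imp_continuous_on ballI has_vector_derivative_continuous[OF q]) auto
  have "closed ({0..T} \<inter> (\<lambda>t. norm (q t - q 0)) -` {r..})"
    by (intro continuous_closed_preimage continuous_intros contq)
  moreover have "{0..T} \<inter> (\<lambda>t. norm (q t - q 0)) -` {r..} = S" by (auto simp: S_def)
  ultimately have "closed S" by simp
  moreover have "bounded S" by (rule bounded_subset[of "{0..T}"]) (auto simp: S_def)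
  ultimately have "compact S" by (simp add: compact_eq_bounded_closed)
  from compact_attains_inf[OF this \<open>S \<noteq> {}\<close>] obtain s where s: "s \<in> S" "\<And>u. u \<in> S \<Longrightarrow> s \<le> u"
    by blast
  have sT: "0 \<le> s" "s \<le> T" "r \<le> norm (q s - q 0)" using s by (auto simp: S_def)
  have "norm (q s - q 0) \<le> c * s - c * 0"
  proof (rule norm_diff_le_of_deriv_bound[OF sT(1)])
    show "(q has_vector_derivative q' u) (at u)" if "0 \<le> u" "u \<le> s" for u
      using q that sT by simp
    show "((\<lambda>u. c * u) has_vector_derivative c) (at u)" for u
      by (auto intro!: derivative_eq_intros simp: has_real_derivative_iff_has_vector_derivative[symmetric])
    show "norm (q' u) \<le> c" if "0 < u" "u < s" for u
    proof (rule bound)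
      have "u \<notin> S" using s(2)[of u] that by auto
      then show "norm (q u - q 0) \<le> r" using that sT by (auto simp: S_def)
    qed (use that sT in auto)
  qed
  also have "\<dots> \<le> c * T" using sT c by (simp add: mult_left_mono)
  finally show False using c sT by simp
qed

lemma finite_common_radius:
  fixes P :: "'i \<Rightarrow> real \<Rightarrow> bool"
  assumes "finite I" "\<And>i. i \<in> I \<Longrightarrow> \<exists>d>0. P i d"
    and "\<And>i d d'. P i d \<Longrightarrow> 0 < d' \<Longrightarrow> d' \<le> d \<Longrightarrow> P i d'"
  shows "\<exists>d>0. \<forall>i\<in>I. P i d"
  using assms(1,2)
proof (induction I)
  case empty
  show ?case by (intro exI[of _ 1]) simp
next
  case (insert i I)
  obtain d where d: "d > 0" "\<forall>i\<in>I. P i d" using insert by blast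
  obtain d' where d': "d' > 0" "P i d'" using insert.prems by blast
  show ?case
    by (rule exI[of _ "min d d'"]) (use d d' assms(3) in \<open>auto intro: assms(3)\<close>)
qed

section \<open>Bumps at the midpoints of the arcs\<close>

context c1_flow
begin

lemma continuous_flow_compose [continuous_intros]:
  assumes "continuous_on S f" "continuous_on S g"
  shows "continuous_on S (\<lambda>x. \<Phi> (f x) (g x))"
  using continuous_on_compose2[OF continuous_flow[of UNIV] continuous_on_Pair[OF assms]] by simp

lemma continuous_D_compose [continuous_intros]:
  assumes "continuous_on S f" "continuous_on S g" "continuous_on S h"
  shows "continuous_on S (\<lambda>x. D (f x) (g x) (h x))"
  using continuous_on_compose2[OF continuous_D continuous_on_Pair[OF assms(1) continuous_on_Pair[OF assms(2,3)]]]
  by simp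

text \<open>A bump must miss the other arcs and meet its own only where the transported basis
  vectors return to within \<kappa> of themselves, as they do near time \<open>T / 2\<close>.
  Compactness gives one radius \<epsilon> for all pairs of arcs.\<close>

lemma orbit_bumps:
  assumes Z: "finite Z" and T: "T > 0" and \<kappa>: "\<kappa> > 0"
    and sep: "\<And>z z' t. \<lbrakk>z \<in> Z; z' \<in> Z; 0 \<le> t; t \<le> T; \<Phi> t z' = \<Phi> (T / 2) z\<rbrakk> \<Longrightarrow> z' = z \<and> t = T / 2"
  obtains \<eta> :: "'a \<Rightarrow> 'a \<Rightarrow> real" where
    "\<And>z. continuous_on UNIV (\<eta> z)" "\<And>z x. 0 \<le> \<eta> z x"
    "\<And>z. z \<in> Z \<Longrightarrow> signed_integral (\<lambda>s. \<eta> z (\<Phi> s z)) T = 1"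
    "\<And>z z' t. \<lbrakk>z \<in> Z; z' \<in> Z; 0 \<le> t; t \<le> T; z' \<noteq> z\<rbrakk> \<Longrightarrow> \<eta> z (\<Phi> t z') = 0"
    "\<And>z t e. \<lbrakk>z \<in> Z; 0 \<le> t; t \<le> T; e \<in> Basis; \<eta> z (\<Phi> t z) \<noteq> 0\<rbrakk>
        \<Longrightarrow> norm (D (- t) (\<Phi> t z) (D (T / 2) z e) - e) \<le> \<kappa>"
proof -
  define F where "F z t = (\<Sum>e\<in>Basis. norm (D (- t) (\<Phi> t z) (D (T / 2) z e) - e))" for z t
  have contF: "continuous_on S (F z)" for S z
    unfolding F_def by (intro continuous_intros)
  \<comment> \<open>The times at which the arc of \<open>z'\<close> has to avoid the bump of
    \<open>z\<close>: all of them for another arc, those with transport error at least \<kappa> for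
    its own.\<close>
  define C where "C z z' = {0..T} \<inter> (if z' = z then F z -` {\<kappa>..} else UNIV)" for z z'
  \<comment> \<open>\<open>D (- (T / 2))\<close> undoes \<open>D (T / 2)\<close>, so the transport
    error vanishes at the midpoint and \<open>T / 2\<close> is not in \<open>C z z\<close>.\<close>
  have F_half: "F z (T / 2) = 0" for z
    by (simp add: F_def D_compose D_0)
  have "\<exists>\<epsilon>>0. \<forall>t\<in>C z z'. \<epsilon> \<le> dist (\<Phi> (T / 2) z) (\<Phi> t z')" if "z \<in> Z" "z' \<in> Z" for z z'
  proof -
    have "closed (C z z')"
      unfolding C_def by (auto intro!: continuous_closed_preimage contF)
    moreover have "bounded (C z z')"
      by (rule bounded_subset[of "{0..T}"]) (auto simp: C_def)
    ultimately have "compact (C z z')" by (simp add: compact_eq_bounded_closed)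
    then have "compact ((\<lambda>t. \<Phi> t z') ` C z z')"
      by (intro compact_continuous_image continuous_intros)
    then have cl: "closed ((\<lambda>t. \<Phi> t z') ` C z z')" by (rule compact_imp_closed)
    have nin: "\<Phi> (T / 2) z \<notin> (\<lambda>t. \<Phi> t z') ` C z z'"
    proof
      assume "\<Phi> (T / 2) z \<in> (\<lambda>t. \<Phi> t z') ` C z z'"
      then obtain t where t: "t \<in> C z z'" "\<Phi> t z' = \<Phi> (T / 2) z" by auto
      then have "z' = z \<and> t = T / 2" using sep that by (auto simp: C_def)
      then show False using t(1) F_half \<kappa> by (auto simp: C_def)
    qed
    from separate_point_closed[OF cl nin] show ?thesis by simp
  qed
  then have ex: "\<exists>\<epsilon>>0. \<forall>t\<in>C (fst p) (snd p). \<epsilon> \<le> dist (\<Phi> (T / 2) (fst p)) (\<Phi> t (snd p))"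
    if "p \<in> Z \<times> Z" for p
    using that by auto
  have "\<exists>\<epsilon>>0. \<forall>p\<in>Z \<times> Z. \<forall>t\<in>C (fst p) (snd p). \<epsilon> \<le> dist (\<Phi> (T / 2) (fst p)) (\<Phi> t (snd p))"
    by (rule finite_common_radius[OF _ ex]) (use Z in \<open>auto intro: order_trans\<close>)
  then obtain \<epsilon> where \<epsilon>: "\<epsilon> > 0"
    and far: "\<And>z z' t. \<lbrakk>z \<in> Z; z' \<in> Z; t \<in> C z z'\<rbrakk> \<Longrightarrow> \<epsilon> \<le> dist (\<Phi> (T / 2) z) (\<Phi> t z')"
    by auto
  define b where "b z x = max 0 (\<epsilon> - dist (\<Phi> (T / 2) z) x)" for z x
  have contb: "continuous_on S (b z)" for S z
    unfolding b_def by (intro continuous_intros)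
  have contbf: "continuous_on S (\<lambda>s. b z (\<Phi> s z))" for S z
    unfolding b_def by (intro continuous_intros)
  have b0: "b z x \<ge> 0" for z x by (simp add: b_def)
  \<comment> \<open>Division by this integral makes a bump contribute exactly 1 along its own arc;
    it is positive since the tent has height \<epsilon> at the midpoint.\<close>
  define c where "c z = integral {0..T} (\<lambda>s. b z (\<Phi> s z))" for z
  have c0: "c z \<ge> 0" for z
    unfolding c_def by (rule integral_nonneg) (auto intro: integrable_continuous_real contbf b0)
  have "c z \<noteq> 0" for z
  proof
    assume "c z = 0"
    then have "\<forall>s\<in>{0..T}. b z (\<Phi> s z) = 0"
      unfolding c_def using integral_eq_0_iff[OF contbf T] b0 by blast
    moreover have "b z (\<Phi> (T / 2) z) = \<epsilon>" using \<epsilon> by (simp add: b_def)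
    ultimately show False using \<epsilon> T by auto
  qed
  then have c: "c z > 0" for z using c0[of z] by (simp add: less_le)
  have supp: "t \<notin> C z z'" if "z \<in> Z" "z' \<in> Z" "b z (\<Phi> t z') \<noteq> 0" for z z' t
    using far[OF that(1,2)] that(3) by (fastforce simp: b_def max_def split: if_splits)
  show ?thesis
  proof (rule that[of "\<lambda>z x. b z x / c z"])
    show "continuous_on UNIV (\<lambda>x. b z x / c z)" for z
      by (intro continuous_intros contb) (use \<open>c z \<noteq> 0\<close> in simp)
    show "0 \<le> b z x / c z" for z x using b0 c0 by simp
    show "signed_integral (\<lambda>s. b z (\<Phi> s z) / c z) T = 1" for z
      using T c[of z] by (simp add: signed_integral_def c_def[symmetric])
    show "b z (\<Phi> t z') / c z = 0" if "z \<in> Z" "z' \<in> Z" "0 \<le> t" "t \<le> T" "z' \<noteq> z" for z z' t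
      using supp[OF that(1,2), of t] that(3-5) by (auto simp: C_def)
    show "norm (D (- t) (\<Phi> t z) (D (T / 2) z e) - e) \<le> \<kappa>"
      if "z \<in> Z" "0 \<le> t" "t \<le> T" "e \<in> Basis" "b z (\<Phi> t z) / c z \<noteq> 0" for z t e
    proof -
      have "t \<notin> C z z" using supp[OF that(1,1), of t] that(5) by auto
      then have "F z t < \<kappa>" using that by (auto simp: C_def)
      moreover have "norm (D (- t) (\<Phi> t z) (D (T / 2) z e) - e) \<le> F z t"
        unfolding F_def by (rule member_le_sum[OF that(4)]) auto
      ultimately show ?thesis by simp
    qed
  qed
qed

end

lemma norm_linear_le_basis:
  fixes A :: "'a::euclidean_space \<Rightarrow> 'b::real_normed_vector"
  assumes A: "linear A" and v: "\<And>e. e \<in> Basis \<Longrightarrow> \<bar>v \<bullet> e\<bar> \<le> R"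
  shows "norm (A v) \<le> R * (\<Sum>e\<in>Basis. norm (A e))"
proof -
  have "A v = A (\<Sum>e\<in>Basis. (v \<bullet> e) *\<^sub>R e)" by (simp add: euclidean_representation)
  also have "norm \<dots> \<le> (\<Sum>e\<in>Basis. \<bar>v \<bullet> e\<bar> * norm (A e))"
    unfolding linear_sum[OF A] by (rule order_trans[OF norm_sum]) (simp add: linear_cmul[OF A])
  also have "\<dots> \<le> (\<Sum>e\<in>Basis. R * norm (A e))"
    using v by (intro sum_mono mult_right_mono) auto
  finally show ?thesis by (simp add: sum_distrib_left)
qed

text \<open>
  The factor \<open>D (T / 2) z'\<close> transports \<open>\<theta> z'\<close> from \<open>z'\<close> to the midpoint of its arc, so that the bump,
  pulled back to time \<open>0\<close>, acts as \<open>\<theta> z'\<close>.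
\<close>

lemma (in c1_flow) controlled_perturbation:
  assumes Z: "finite Z" "Z \<noteq> {}" and T: "T > 0"
    and sep: "\<And>z z' t. \<lbrakk>z \<in> Z; z' \<in> Z; 0 \<le> t; t \<le> T; \<Phi> t z' = \<Phi> (T / 2) z\<rbrakk> \<Longrightarrow> z' = z \<and> t = T / 2"
  obtains \<eta> :: "'a \<Rightarrow> 'a \<Rightarrow> real" and \<rho> \<delta> K where     "\<And>\<theta> U X z. \<lbrakk>z \<in> Z; \<And>z' e. z' \<in> Z \<Longrightarrow> e \<in> Basis \<Longrightarrow> \<bar>\<theta> z' \<bullet> e\<bar> \<le> \<rho>;
       \<And>x. x \<in> K \<Longrightarrow> norm (U x - (V x + (\<Sum>z'\<in>Z. \<eta> z' x *\<^sub>R D (T / 2) z' (\<theta> z')))) \<le> \<delta>;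
       X 0 = z; \<And>t. 0 \<le> t \<Longrightarrow> t \<le> T \<Longrightarrow> (X has_vector_derivative U (X t)) (at t)\<rbrakk>
      \<Longrightarrow> (\<forall>t\<in>{0..T}. X t \<in> K) \<and> norm (\<Phi> (- T) (X T) - z - \<theta> z) \<le> \<rho>"
    "compact K" "\<rho> > 0" "\<delta> > 0" "\<And>z. continuous_on UNIV (\<eta> z)"
proof -
  define N where "N = real DIM('a)"
  define m where "m = real (card Z)"
  have N: "N > 0" by (simp add: N_def)
  have m: "m > 0" using Z by (simp add: m_def card_gt_0_iff)
  \<comment> \<open>The transport tolerance is incurred for each of the \<open>N\<close> basis
    vectors, which makes a quarter of \<rho> in total.\<close>
  have N4: "1 / (4 * N) > 0" using N by simp
  obtain \<eta> :: "'a \<Rightarrow> 'a \<Rightarrow> real" where cont\<eta>: "\<And>z. continuous_on UNIV (\<eta> z)" and \<eta>0: "\<And>z x. 0 \<le> \<eta> z x"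
    and \<eta>1: "\<And>z. z \<in> Z \<Longrightarrow> signed_integral (\<lambda>s. \<eta> z (\<Phi> s z)) T = 1"
    and \<eta>_off: "\<And>z z' t. \<lbrakk>z \<in> Z; z' \<in> Z; 0 \<le> t; t \<le> T; z' \<noteq> z\<rbrakk> \<Longrightarrow> \<eta> z (\<Phi> t z') = 0"
    and \<eta>_on: "\<And>z t e. \<lbrakk>z \<in> Z; 0 \<le> t; t \<le> T; e \<in> Basis; \<eta> z (\<Phi> t z) \<noteq> 0\<rbrakk>
        \<Longrightarrow> norm (D (- t) (\<Phi> t z) (D (T / 2) z e) - e) \<le> 1 / (4 * N)"
    by (rule orbit_bumps[OF Z(1) T N4]) (erule (4) sep, rule that)
  have cont\<eta>': "continuous_on S (\<lambda>x. \<eta> z (f x))" if "continuous_on S f" for z S and f :: "'b::topological_space \<Rightarrow> 'a"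
    by (rule continuous_on_compose2[OF cont\<eta> that]) simp
  define P where "P \<theta> x = (\<Sum>z'\<in>Z. \<eta> z' x *\<^sub>R D (T / 2) z' (\<theta> z'))" for \<theta> x
  \<comment> \<open>The bump of \<open>z'\<close> in direction \<open>e\<close>, pulled back to time
    0 from the point \<open>\<Phi> t q\<close>. It does not involve \<theta>, so its modulus of
    continuity in \<open>q\<close> is uniform in the parameters.\<close>
  define \<Psi> where "\<Psi> z' e t q = \<eta> z' (\<Phi> t q) *\<^sub>R D (- t) (\<Phi> t q) (D (T / 2) z' e)" for z' e t q
  have D_basis: "D t x v = (\<Sum>e\<in>Basis. (v \<bullet> e) *\<^sub>R D t x e)" for t x v
  proof -
    have "D t x (\<Sum>e\<in>Basis. (v \<bullet> e) *\<^sub>R e) = (\<Sum>e\<in>Basis. (v \<bullet> e) *\<^sub>R D t x e)"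
      by (simp add: linear_sum[OF linear_D] linear_cmul[OF linear_D])
    then show ?thesis by (simp add: euclidean_representation)
  qed
  have pull: "D (- t) (\<Phi> t q) (P \<theta> (\<Phi> t q)) = (\<Sum>z'\<in>Z. \<Sum>e\<in>Basis. (\<theta> z' \<bullet> e) *\<^sub>R \<Psi> z' e t q)" for t q \<theta>
  proof -
    have DD: "D (- t) (\<Phi> t q) (D (T / 2) z' v) = (\<Sum>e\<in>Basis. (v \<bullet> e) *\<^sub>R D (- t) (\<Phi> t q) (D (T / 2) z' e))" for z' v
      unfolding D_basis[of "T / 2" z' v] by (simp add: linear_sum[OF linear_D] linear_cmul[OF linear_D])
    have "D (- t) (\<Phi> t q) (P \<theta> (\<Phi> t q)) = (\<Sum>z'\<in>Z. \<eta> z' (\<Phi> t q) *\<^sub>R D (- t) (\<Phi> t q) (D (T / 2) z' (\<theta> z')))"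
      by (simp add: P_def linear_sum[OF linear_D] linear_cmul[OF linear_D])
    also have "\<dots> = (\<Sum>z'\<in>Z. \<Sum>e\<in>Basis. (\<theta> z' \<bullet> e) *\<^sub>R \<Psi> z' e t q)"
    proof (rule sum.cong[OF refl])
      fix z'
      show "\<eta> z' (\<Phi> t q) *\<^sub>R D (- t) (\<Phi> t q) (D (T / 2) z' (\<theta> z')) = (\<Sum>e\<in>Basis. (\<theta> z' \<bullet> e) *\<^sub>R \<Psi> z' e t q)"
        unfolding DD[of z' "\<theta> z'"] \<Psi>_def scaleR_sum_right by (intro sum.cong refl scaleR_left_commute)
    qed
    finally show ?thesis .
  qed
  \<comment> \<open>Over \<open>m * N\<close> terms and time \<open>T\<close>, replacing
    \<open>q\<close> by \<open>z\<close> costs at most \<open>m * N * T * \<rho> * \<gamma>\<close>,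
    a quarter of \<rho>.\<close>
  define \<gamma> where "\<gamma> = 1 / (4 * m * N * T)"
  have \<gamma>: "\<gamma> > 0" using m N T by (simp add: \<gamma>_def)
  have near: "\<exists>r>0. \<forall>t q. 0 \<le> t \<and> t \<le> T \<and> norm (q - fst p) \<le> r \<longrightarrow>
      norm (\<Psi> (fst (snd p)) (snd (snd p)) t q - \<Psi> (fst (snd p)) (snd (snd p)) t (fst p)) \<le> \<gamma>" for p
  proof -
    let ?f = "\<lambda>y. \<Psi> (fst (snd p)) (snd (snd p)) (fst y) (snd y)" and ?S = "{0..T} \<times> cball (fst p) 1"
    have "continuous_on ?S ?f"
      unfolding \<Psi>_def by (intro continuous_intros cont\<eta>')
    then have "uniformly_continuous_on ?S ?f"
      by (rule compact_uniformly_continuous) (intro compact_Times compact_Icc compact_cball)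
    then obtain d where d: "d > 0" and unif: "\<And>y y'. \<lbrakk>y \<in> ?S; y' \<in> ?S; dist y' y < d\<rbrakk> \<Longrightarrow> dist (?f y') (?f y) < \<gamma>"
      using \<gamma> unfolding uniformly_continuous_on_def by metis
    show ?thesis
    proof (intro exI[of _ "min 1 (d / 2)"] conjI allI impI)
      show "min 1 (d / 2) > 0" using d by simp
      fix t q assume *: "0 \<le> t \<and> t \<le> T \<and> norm (q - fst p) \<le> min 1 (d / 2)"
      have "dist (?f (t, q)) (?f (t, fst p)) < \<gamma>"
      proof (rule unif)
        show "(t, fst p) \<in> ?S" using * by simp
        show "(t, q) \<in> ?S" using * by (simp add: dist_norm norm_minus_commute)
        show "dist (t, q) (t, fst p) < d" using * d by (simp add: dist_Pair_Pair dist_norm)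
      qed
      then show "norm (\<Psi> (fst (snd p)) (snd (snd p)) t q - \<Psi> (fst (snd p)) (snd (snd p)) t (fst p)) \<le> \<gamma>"
        by (simp add: dist_norm)
    qed
  qed
  have "\<exists>r>0. \<forall>p \<in> Z \<times> Z \<times> (Basis :: 'a set). \<forall>t q. 0 \<le> t \<and> t \<le> T \<and> norm (q - fst p) \<le> r \<longrightarrow>
      norm (\<Psi> (fst (snd p)) (snd (snd p)) t q - \<Psi> (fst (snd p)) (snd (snd p)) t (fst p)) \<le> \<gamma>"
    by (rule finite_common_radius[OF _ near]) (use Z in auto)
  then obtain r0 where r0: "r0 > 0" and \<Psi>_near0: "\<And>z z' e t q. \<lbrakk>z \<in> Z; z' \<in> Z; e \<in> Basis; 0 \<le> t; t \<le> T; norm (q - z) \<le> r0\<rbrakk>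
      \<Longrightarrow> norm (\<Psi> z' e t q - \<Psi> z' e t z) \<le> \<gamma>"
    by force
  define r where "r = min 1 r0"
  have r: "r > 0" "r \<le> 1" using r0 by (simp_all add: r_def)
  have \<Psi>_near: "norm (\<Psi> z' e t q - \<Psi> z' e t z) \<le> \<gamma>"
    if "z \<in> Z" "z' \<in> Z" "e \<in> Basis" "0 \<le> t" "t \<le> T" "norm (q - z) \<le> r" for z z' e t q
    using \<Psi>_near0[OF that(1-5)] that(6) by (simp add: r_def)
  \<comment> \<open>A compact tube around the arcs, fixed before \<rho> and \<delta>; the radius 1
    is enough because \<open>r \<le> 1\<close>.\<close>
  define K where "K = (\<lambda>p. \<Phi> (fst p) (snd p)) ` ({0..T} \<times> (\<Union>z\<in>Z. cball z 1))"
  have K: "compact K"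
    unfolding K_def using Z
    by (intro compact_continuous_image continuous_flow compact_Times compact_Icc compact_UN compact_cball)
  obtain CD where CD: "CD > 0" and CD_bound: "\<And>t x v. \<lbrakk>0 \<le> t; t \<le> T; x \<in> K\<rbrakk> \<Longrightarrow> norm (D (- t) x v) \<le> CD * norm v"
  proof -
    have "compact ((\<lambda>p. D (- fst p) (fst (snd p)) (snd (snd p))) ` ({0..T} \<times> K \<times> cball 0 1))"
      by (intro compact_continuous_image continuous_intros compact_Times compact_Icc K compact_cball)
    from compact_imp_bounded[OF this] obtain B where B: "B > 0"
      "\<forall>y\<in>(\<lambda>p. D (- fst p) (fst (snd p)) (snd (snd p))) ` ({0..T} \<times> K \<times> cball 0 1). norm y \<le> B"
      unfolding bounded_pos by blast
    show ?thesis
    proof (rule that[OF B(1)])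
      fix t x and v :: 'a assume *: "0 \<le> t" "t \<le> T" "x \<in> K"
      show "norm (D (- t) x v) \<le> B * norm v"
      proof (cases "v = 0")
        case True
        then show ?thesis by (simp add: linear_0[OF linear_D])
      next
        case False
        have "norm (D (- t) x (v /\<^sub>R norm v)) \<le> B"
        proof (rule bspec[OF B(2)], rule image_eqI)
          show "D (- t) x (v /\<^sub>R norm v) = D (- fst (t, x, v /\<^sub>R norm v)) (fst (snd (t, x, v /\<^sub>R norm v))) (snd (snd (t, x, v /\<^sub>R norm v)))"
            by simp
        qed (use * False in simp)
        then show ?thesis using False by (simp add: linear_cmul[OF linear_D] field_simps)
      qed
    qed
  qed
  define G where "G x = (\<Sum>z'\<in>Z. \<eta> z' x * (\<Sum>e\<in>Basis. norm (D (T / 2) z' e)))" for x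
  have "continuous_on K G"
    unfolding G_def by (intro continuous_intros continuous_on_subset[OF cont\<eta>] subset_UNIV)
  then have "compact (G ` K)" using K by (rule compact_continuous_image)
  then obtain CP where CP: "CP > 0" "\<And>x. x \<in> K \<Longrightarrow> \<bar>G x\<bar> \<le> CP"
    using compact_imp_bounded[of "G ` K"] unfolding bounded_pos by auto
  have P_bound: "norm (P \<theta> x) \<le> CP * R"
    if x: "x \<in> K" and bd: "\<And>z' e. z' \<in> Z \<Longrightarrow> e \<in> Basis \<Longrightarrow> \<bar>\<theta> z' \<bullet> e\<bar> \<le> R" and R: "R \<ge> 0" for x \<theta> R
  proof -
    have A: "norm (D (T / 2) z' (\<theta> z')) \<le> R * (\<Sum>e\<in>Basis. norm (D (T / 2) z' e))" if z': "z' \<in> Z" for z'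
      using linear_D bd[OF z'] by (rule norm_linear_le_basis)
    have "norm (P \<theta> x) \<le> (\<Sum>z'\<in>Z. \<eta> z' x * norm (D (T / 2) z' (\<theta> z')))"
      unfolding P_def by (rule order_trans[OF norm_sum]) (simp add: \<eta>0)
    also have "\<dots> \<le> (\<Sum>z'\<in>Z. \<eta> z' x * (R * (\<Sum>e\<in>Basis. norm (D (T / 2) z' e))))"
      using A \<eta>0 by (intro sum_mono mult_left_mono) auto
    also have "\<dots> = R * G x"
      by (simp add: G_def sum_distrib_left mult_ac)
    also have "\<dots> \<le> R * CP" using CP(2)[OF x] R by (intro mult_left_mono) auto
    finally show ?thesis by (simp add: mult.commute)
  qed
  \<comment> \<open>In the tube the pulled-back curve has speed at most \<open>C1 * \<rho>\<close>:
    \<open>CP * \<rho>\<close> from the bumps and at most \<rho> from the approximation, times the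
    factor \<open>CD\<close> of the pull-back.\<close>
  define C1 where "C1 = CD * (1 + CP)"
  have C1: "C1 > 0" using CD CP by (simp add: C1_def)
  \<comment> \<open>Small enough that \<open>C1 * \<rho> * T < r\<close>, so the curve cannot leave
    the ball in which the estimates hold.\<close>
  define \<rho> where "\<rho> = r / (2 * (C1 * T + 1))"
  have C1T: "C1 * T + 1 > 0" using C1 T by (simp add: add_pos_pos)
  have \<rho>: "\<rho> > 0" using r C1T by (simp add: \<rho>_def)
  have "C1 * \<rho> * T = r * (C1 * T / (2 * (C1 * T + 1)))" by (simp add: \<rho>_def)
  also have "\<dots> < r * 1"
    using r C1T mult_pos_pos[OF C1 T] by (intro mult_strict_left_mono) (simp_all add: divide_less_eq)
  finally have conf: "C1 * \<rho> * T < r" by simp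
  \<comment> \<open>The first bound serves the confinement; the second makes the integrated
    approximation error at most a quarter of \<rho>.\<close>
  define \<delta> where "\<delta> = min \<rho> (\<rho> / (4 * CD * T))"
  have \<delta>: "\<delta> > 0" "\<delta> \<le> \<rho>" using \<rho> CD T by (simp_all add: \<delta>_def)
  have "CD * \<delta> \<le> CD * (\<rho> / (4 * CD * T))" using CD by (intro mult_left_mono) (simp_all add: \<delta>_def)
  then have \<delta>2: "CD * \<delta> \<le> \<rho> / (4 * T)" using CD by simp
  show ?thesis
  proof (rule that[OF _ K \<rho> \<delta>(1) cont\<eta>])
    fix \<theta> U X z
    assume z: "z \<in> Z" and \<theta>: "\<And>z' e. z' \<in> Z \<Longrightarrow> e \<in> Basis \<Longrightarrow> \<bar>\<theta> z' \<bullet> e\<bar> \<le> \<rho>"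
      and U: "\<And>x. x \<in> K \<Longrightarrow> norm (U x - (V x + (\<Sum>z'\<in>Z. \<eta> z' x *\<^sub>R D (T / 2) z' (\<theta> z')))) \<le> \<delta>"
      and X: "X 0 = z" "\<And>t. 0 \<le> t \<Longrightarrow> t \<le> T \<Longrightarrow> (X has_vector_derivative U (X t)) (at t)"
    define q where "q t = \<Phi> (- t) (X t)" for t
    define q' where "q' t = D (- t) (X t) (U (X t) - V (X t))" for t
    have dq: "(q has_vector_derivative q' t) (at t)" if "0 \<le> t" "t \<le> T" for t
      unfolding q_def[abs_def] q'_def by (rule has_vector_derivative_pullback[OF X(2)[OF that]])
    have q0: "q 0 = z" by (simp add: q_def flow_0 X)
    have Xq: "X t = \<Phi> t (q t)" for t by (simp add: q_def flow_minus)
    have inK: "X t \<in> K" if "0 \<le> t" "t \<le> T" "norm (q t - z) \<le> r" for t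
    proof -
      have "q t \<in> cball z 1" using that r by (simp add: dist_norm norm_minus_commute)
      then have "(t, q t) \<in> {0..T} \<times> (\<Union>z\<in>Z. cball z 1)" using that z by auto
      then have "\<Phi> (fst (t, q t)) (snd (t, q t)) \<in> K" unfolding K_def by (rule imageI)
      then show ?thesis by (simp add: Xq)
    qed
    have U': "norm (U x - V x - P \<theta> x) \<le> \<delta>" if "x \<in> K" for x
      using U[OF that] by (simp add: P_def diff_diff_eq)
    have small: "norm (q t - q 0) < r" if "0 \<le> t" "t \<le> T" for t
    proof (rule confined_of_deriv_bound[OF dq])
      show "norm (q' t) \<le> C1 * \<rho>" if "0 \<le> t" "t \<le> T" "norm (q t - q 0) \<le> r" for t
      proof -
        have XK: "X t \<in> K" using inK that by (simp add: q0)
        have "norm (U (X t) - V (X t)) \<le> norm (P \<theta> (X t)) + norm (U (X t) - V (X t) - P \<theta> (X t))"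
          by (rule norm_triangle_sub)
        also have "\<dots> \<le> CP * \<rho> + \<delta>"
          using U'[OF XK] P_bound[OF XK \<theta>] \<rho> by (intro add_mono) auto
        also have "\<dots> \<le> (1 + CP) * \<rho>" using \<delta>(2) by (simp add: algebra_simps)
        finally have "CD * norm (U (X t) - V (X t)) \<le> CD * ((1 + CP) * \<rho>)" using CD by simp
        then show ?thesis
          using CD_bound[OF that(1,2) XK, of "U (X t) - V (X t)"] by (simp add: q'_def C1_def mult.assoc)
      qed
    qed (use C1 \<rho> conf that in auto)
    then have close: "norm (q t - z) \<le> r" if "0 \<le> t" "t \<le> T" for t
      using that by (simp add: q0 less_imp_le)
    have XK: "X t \<in> K" if "0 \<le> t" "t \<le> T" for t
      using inK close that by blast
    \<comment> \<open>The fraction of the push by \<open>\<theta> z\<close> that the bump has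
      delivered by time \<open>t\<close> on the unperturbed arc; it goes from 0 to 1.\<close>
    define \<kappa> where "\<kappa> = signed_integral (\<lambda>s. \<eta> z (\<Phi> s z))"
    have d\<kappa>: "(\<kappa> has_vector_derivative \<eta> z (\<Phi> t z)) (at t)" for t
      unfolding \<kappa>_def by (intro has_vector_derivative_signed_integral cont\<eta>' continuous_intros)
    \<comment> \<open>The majorant has slope \<open>\<rho> / (2 * T)\<close> for approximation and
      drift together and \<open>\<rho> / 4\<close> times the bump for the transport error; the total
      is three quarters of \<rho>.\<close>
    have "norm ((q T - \<kappa> T *\<^sub>R \<theta> z) - (q 0 - \<kappa> 0 *\<^sub>R \<theta> z))
        \<le> (\<rho> / (2 * T) * T + \<rho> / 4 * \<kappa> T) - (\<rho> / (2 * T) * 0 + \<rho> / 4 * \<kappa> 0)"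
    proof (rule norm_diff_le_of_deriv_bound)
      show "((\<lambda>t. q t - \<kappa> t *\<^sub>R \<theta> z) has_vector_derivative q' t - \<eta> z (\<Phi> t z) *\<^sub>R \<theta> z) (at t)"
        if "0 \<le> t" "t \<le> T" for t
        using bounded_linear.has_vector_derivative[OF bounded_linear_scaleR_left d\<kappa>, of "\<theta> z" t]
        by (intro has_vector_derivative_diff dq that)
      show "((\<lambda>t. \<rho> / (2 * T) * t + \<rho> / 4 * \<kappa> t) has_vector_derivative \<rho> / (2 * T) + \<rho> / 4 * \<eta> z (\<Phi> t z)) (at t)" for t
        using d\<kappa>[of t] T unfolding has_real_derivative_iff_has_vector_derivative[symmetric]
        by (auto intro!: derivative_eq_intros)
      fix t assume "0 < t" "t < T"
      then have t: "0 \<le> t" "t \<le> T" by auto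
      define E where "E = U (X t) - V (X t) - P \<theta> (X t)"
      define S where "S y = (\<Sum>z'\<in>Z. \<Sum>e\<in>Basis. (\<theta> z' \<bullet> e) *\<^sub>R \<Psi> z' e t y)" for y
      have "q' t = D (- t) (X t) (E + P \<theta> (X t))" by (simp add: q'_def E_def)
      also have "\<dots> = D (- t) (X t) E + S (q t)"
        using pull[of t "q t" \<theta>] by (simp add: linear_add[OF linear_D] S_def Xq[symmetric])
      finally have q't: "q' t = D (- t) (X t) E + S (q t)" .
      have "norm (D (- t) (X t) E) \<le> CD * norm E" by (rule CD_bound[OF t XK[OF t]])
      also have "\<dots> \<le> CD * \<delta>" using U'[OF XK[OF t]] CD by (simp add: E_def)
      finally have 1: "norm (D (- t) (X t) E) \<le> \<rho> / (4 * T)" using \<delta>2 by simp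
      have "norm (S (q t) - S z) = norm (\<Sum>z'\<in>Z. \<Sum>e\<in>Basis. (\<theta> z' \<bullet> e) *\<^sub>R (\<Psi> z' e t (q t) - \<Psi> z' e t z))"
        by (simp add: S_def sum_subtractf scaleR_diff_right)
      also have "\<dots> \<le> (\<Sum>z'\<in>Z. \<Sum>e\<in>(Basis :: 'a set). \<rho> * \<gamma>)"
      proof (intro sum_norm_le)
        fix z' e :: 'a assume *: "z' \<in> Z" "e \<in> Basis"
        have "\<bar>\<theta> z' \<bullet> e\<bar> * norm (\<Psi> z' e t (q t) - \<Psi> z' e t z) \<le> \<rho> * \<gamma>"
          using \<theta>[OF *] \<Psi>_near[OF z * t close[OF t]] \<rho> by (intro mult_mono) auto
        then show "norm ((\<theta> z' \<bullet> e) *\<^sub>R (\<Psi> z' e t (q t) - \<Psi> z' e t z)) \<le> \<rho> * \<gamma>" by simp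
      qed
      also have "\<dots> = m * N * (\<rho> * \<gamma>)" by (simp add: m_def N_def)
      also have "\<dots> = \<rho> / (4 * T)" using m N T by (simp add: \<gamma>_def field_simps)
      finally have 2: "norm (S (q t) - S z) \<le> \<rho> / (4 * T)" .
      \<comment> \<open>On the unperturbed arc of \<open>z\<close> the other bumps vanish, which
        decouples the parameters.\<close>
      have "\<Psi> z' e t z = 0" if "z' \<in> Z - {z}" for z' e
        using \<eta>_off[of z' z t] that z t by (auto simp: \<Psi>_def)
      then have "(\<Sum>z'\<in>Z - {z}. \<Sum>e\<in>Basis. (\<theta> z' \<bullet> e) *\<^sub>R \<Psi> z' e t z) = 0"
        by (intro sum.neutral ballI) auto
      then have "S z = (\<Sum>e\<in>Basis. (\<theta> z \<bullet> e) *\<^sub>R \<Psi> z e t z)"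
        unfolding S_def using sum.remove[OF Z(1) z, of "\<lambda>z'. \<Sum>e\<in>Basis. (\<theta> z' \<bullet> e) *\<^sub>R \<Psi> z' e t z"] by simp
      moreover have "\<eta> z (\<Phi> t z) *\<^sub>R \<theta> z = (\<Sum>e\<in>Basis. (\<theta> z \<bullet> e) *\<^sub>R \<eta> z (\<Phi> t z) *\<^sub>R e)"
      proof -
        have "\<eta> z (\<Phi> t z) *\<^sub>R (\<Sum>e\<in>Basis. (\<theta> z \<bullet> e) *\<^sub>R e) = (\<Sum>e\<in>Basis. (\<theta> z \<bullet> e) *\<^sub>R \<eta> z (\<Phi> t z) *\<^sub>R e)"
          by (simp add: scaleR_sum_right mult.commute)
        then show ?thesis by (simp add: euclidean_representation)
      qed
      ultimately have "S z - \<eta> z (\<Phi> t z) *\<^sub>R \<theta> z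
          = (\<Sum>e\<in>Basis. (\<theta> z \<bullet> e) *\<^sub>R \<eta> z (\<Phi> t z) *\<^sub>R (D (- t) (\<Phi> t z) (D (T / 2) z e) - e))"
        by (simp add: \<Psi>_def sum_subtractf scaleR_diff_right)
      also have "norm \<dots> \<le> (\<Sum>e\<in>(Basis :: 'a set). \<rho> * (\<eta> z (\<Phi> t z) * (1 / (4 * N))))"
      proof (intro sum_norm_le)
        fix e :: 'a assume e: "e \<in> Basis"
        have "\<eta> z (\<Phi> t z) * norm (D (- t) (\<Phi> t z) (D (T / 2) z e) - e) \<le> \<eta> z (\<Phi> t z) * (1 / (4 * N))"
        proof (cases "\<eta> z (\<Phi> t z) = 0")
          case False
          show ?thesis by (rule mult_left_mono[OF \<eta>_on[OF z t e False] \<eta>0])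
        qed simp
        then have "\<bar>\<theta> z \<bullet> e\<bar> * (\<eta> z (\<Phi> t z) * norm (D (- t) (\<Phi> t z) (D (T / 2) z e) - e))
            \<le> \<rho> * (\<eta> z (\<Phi> t z) * (1 / (4 * N)))"
          by (rule mult_mono[OF \<theta>[OF z e]]) (use \<rho> \<eta>0 in auto)
        then show "norm ((\<theta> z \<bullet> e) *\<^sub>R \<eta> z (\<Phi> t z) *\<^sub>R (D (- t) (\<Phi> t z) (D (T / 2) z e) - e))
            \<le> \<rho> * (\<eta> z (\<Phi> t z) * (1 / (4 * N)))"
          by (simp add: \<eta>0 abs_mult mult.assoc)
      qed
      also have "\<dots> = N * (\<rho> * (\<eta> z (\<Phi> t z) * (1 / (4 * N))))" by (simp add: N_def)
      also have "\<dots> = \<rho> / 4 * \<eta> z (\<Phi> t z)" using N by simp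
      finally have 3: "norm (S z - \<eta> z (\<Phi> t z) *\<^sub>R \<theta> z) \<le> \<rho> / 4 * \<eta> z (\<Phi> t z)" .
      have "q' t - \<eta> z (\<Phi> t z) *\<^sub>R \<theta> z = D (- t) (X t) E + (S (q t) - S z) + (S z - \<eta> z (\<Phi> t z) *\<^sub>R \<theta> z)"
        by (simp add: q't)
      then have "norm (q' t - \<eta> z (\<Phi> t z) *\<^sub>R \<theta> z) \<le> \<rho> / (4 * T) + \<rho> / (4 * T) + \<rho> / 4 * \<eta> z (\<Phi> t z)"
        using norm_triangle_mono[OF norm_triangle_mono[OF 1 2] 3] by simp
      then show "norm (q' t - \<eta> z (\<Phi> t z) *\<^sub>R \<theta> z) \<le> \<rho> / (2 * T) + \<rho> / 4 * \<eta> z (\<Phi> t z)"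
        by simp
    qed (use T in simp)
    moreover have "\<kappa> T = 1" "\<kappa> 0 = 0" using \<eta>1[OF z] by (simp_all add: \<kappa>_def)
    ultimately have "norm (q T - z - \<theta> z) \<le> \<rho> / 2 + \<rho> / 4"
      using T by (simp add: q0 algebra_simps)
    then have "norm (q T - z - \<theta> z) \<le> \<rho>" using \<rho> by simp
    then show "(\<forall>t\<in>{0..T}. X t \<in> K) \<and> norm (\<Phi> (- T) (X T) - z - \<theta> z) \<le> \<rho>"
      using XK by (simp add: q_def)
  qed
qed

section \<open>Exact interpolation by ReLU fields\<close>

lemma scalar_relu_lipschitz:
  fixes g :: "real ^ 'n \<Rightarrow> real"
  assumes "scalar_relu g"
  obtains L where "L-lipschitz_on UNIV g"
proof -
  obtain w :: "real ^ 'n" where w: "w \<in> Basis" using nonempty_Basis by blast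
  have "(\<lambda>x. g x *\<^sub>R w) \<in> relu_class" using assms by (simp add: scalar_relu_def)
  then obtain L where L: "L-lipschitz_on UNIV (\<lambda>x. g x *\<^sub>R w)" by (rule relu_class_lipschitz)
  have "L-lipschitz_on UNIV g"
  proof (rule lipschitz_onI)
    show "0 \<le> L" by (rule lipschitz_on_nonneg[OF L])
    show "dist (g x) (g y) \<le> L * dist x y" for x y
      using lipschitz_onD[OF L, of x y] w by (simp add: dist_norm scaleR_diff_left[symmetric])
  qed
  then show ?thesis by (rule that)
qed

text \<open>The approximants of \<open>V\<close> and of the bumps are chosen once and for all, so
  the field \<open>U u\<close> is affine in the parameters \<open>u\<close>. This gives one error
  bound and one Lipschitz constant for the whole cube, and endpoints that depend continuously on
  \<open>u\<close>.\<close>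

lemma relu_flow_interpolation:
  fixes \<Phi> :: "real \<Rightarrow> real ^ 'n \<Rightarrow> real ^ 'n"
  assumes flow: "c1_flow \<Phi> V D" and Z: "finite Z" "Z \<noteq> {}" and T: "T > 0"
    and sep: "\<And>z z' t. \<lbrakk>z \<in> Z; z' \<in> Z; 0 \<le> t; t \<le> T; \<Phi> t z' = \<Phi> (T / 2) z\<rbrakk> \<Longrightarrow> z' = z \<and> t = T / 2"
  obtains W \<Psi> where "W \<in> relu_class" "global_flow W \<Psi>" "\<And>z. z \<in> Z \<Longrightarrow> \<Psi> T z = \<Phi> T z"
proof -
  interpret c1_flow \<Phi> V D by (rule flow)
  show ?thesis
  proof (rule controlled_perturbation[OF Z T])
    show "z' = z \<and> t = T / 2" if "z \<in> Z" "z' \<in> Z" "0 \<le> t" "t \<le> T" "\<Phi> t z' = \<Phi> (T / 2) z" for z z' t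
      using that by (rule sep)
  next
    fix \<eta> :: "real ^ 'n \<Rightarrow> real ^ 'n \<Rightarrow> real" and \<rho> \<delta> :: real and K
    assume main: "\<And>\<theta> U X z. \<lbrakk>z \<in> Z; \<And>z' e. z' \<in> Z \<Longrightarrow> e \<in> Basis \<Longrightarrow> \<bar>\<theta> z' \<bullet> e\<bar> \<le> \<rho>;
         \<And>x. x \<in> K \<Longrightarrow> norm (U x - (V x + (\<Sum>z'\<in>Z. \<eta> z' x *\<^sub>R D (T / 2) z' (\<theta> z')))) \<le> \<delta>;
         X 0 = z; \<And>t. 0 \<le> t \<Longrightarrow> t \<le> T \<Longrightarrow> (X has_vector_derivative U (X t)) (at t)\<rbrakk>
        \<Longrightarrow> (\<forall>t\<in>{0..T}. X t \<in> K) \<and> norm (\<Phi> (- T) (X T) - z - \<theta> z) \<le> \<rho>"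
      and K: "compact K" and \<rho>: "\<rho> > 0" and \<delta>: "\<delta> > 0"
      and cont\<eta>: "\<And>z. continuous_on UNIV (\<eta> z)"
    define A where "A z = D (T / 2) z" for z
    define a where "a z = (\<Sum>e\<in>Basis. norm (A z e))" for z
    have linA: "linear (A z)" for z by (simp add: A_def linear_D)
    have a0: "a z \<ge> 0" for z by (simp add: a_def sum_nonneg)
    have A_le: "norm (A z v) \<le> R * a z" if "\<And>e. e \<in> Basis \<Longrightarrow> \<bar>v \<bullet> e\<bar> \<le> R" for z v R
      unfolding a_def using linA that by (rule norm_linear_le_basis)
    \<comment> \<open>The bump errors, weighted by at most \<open>\<rho> * a z\<close>, have to add
      up to at most \<delta> / 2; the 1 keeps \<open>s\<close> positive.\<close>
    define s where "s = (\<Sum>z\<in>Z. a z) + 1"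
    have s: "s > 0" using a0 by (simp add: s_def sum_nonneg add_nonneg_pos)
    obtain V0 where V0: "V0 \<in> relu_class" "\<And>x. x \<in> K \<Longrightarrow> norm (V x - V0 x) < \<delta> / 2"
      using relu_class_dense[OF K continuous_on_subset[OF continuous_field subset_UNIV], of "\<delta> / 2"] \<delta> by auto
    have "\<exists>g. scalar_relu g \<and> (\<forall>x\<in>K. \<bar>\<eta> z x - g x\<bar> < \<delta> / (2 * \<rho> * s))" for z
      using scalar_relu_dense[OF K continuous_on_subset[OF cont\<eta> subset_UNIV], of "\<delta> / (2 * \<rho> * s)" z] \<delta> \<rho> s
      by (metis divide_pos_pos mult_pos_pos zero_less_numeral)
    then obtain g where g: "\<And>z. scalar_relu (g z)" "\<And>z x. x \<in> K \<Longrightarrow> \<bar>\<eta> z x - g z x\<bar> < \<delta> / (2 * \<rho> * s)"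
      by metis
    define \<theta> where "\<theta> u z = (\<Sum>e\<in>Basis. u (z, e) *\<^sub>R e)" for u :: "(real ^ 'n) \<times> (real ^ 'n) \<Rightarrow> real" and z
    have \<theta>: "\<theta> u z \<bullet> e = u (z, e)" if "e \<in> Basis" for u z e
      using that by (simp add: \<theta>_def inner_sum_left_Basis)
    define I where "I = Z \<times> (Basis :: (real ^ 'n) set)"
    have I: "finite I" using Z by (simp add: I_def)
    define cube where "cube u \<longleftrightarrow> (\<forall>k\<in>I. \<bar>u k\<bar> \<le> \<rho>)" for u
    have cube: "\<bar>\<theta> u z \<bullet> e\<bar> \<le> \<rho>" if "cube u" "z \<in> Z" "e \<in> Basis" for u z e
      using that by (auto simp: cube_def I_def \<theta>)
    define U where "U u x = V0 x + (\<Sum>z\<in>Z. g z x *\<^sub>R A z (\<theta> u z))" for u x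
    have U_relu: "U u \<in> relu_class" for u
      unfolding U_def[abs_def] using g(1) by (intro relu_class_add V0 relu_class_sum) (simp add: scalar_relu_def)
    have "\<exists>\<Psi>. global_flow (U u) \<Psi>" for u
      using relu_class_lipschitz[OF U_relu] lipschitz_global_flow by metis
    then obtain \<Psi> where \<Psi>: "\<And>u. global_flow (U u) (\<Psi> u)" by metis
    have \<Psi>0: "\<Psi> u 0 z = z" and d\<Psi>: "((\<lambda>s. \<Psi> u s z) has_vector_derivative U u (\<Psi> u t z)) (at t)" for u z t
      using \<Psi>[of u] by (auto simp: global_flow_def)
    have U_close: "norm (U u x - (V x + (\<Sum>z\<in>Z. \<eta> z x *\<^sub>R D (T / 2) z (\<theta> u z)))) \<le> \<delta>"
      if u: "cube u" and x: "x \<in> K" for u x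
    proof -
      have "norm (\<Sum>z\<in>Z. (g z x - \<eta> z x) *\<^sub>R A z (\<theta> u z)) \<le> (\<Sum>z\<in>Z. \<delta> / (2 * \<rho> * s) * (\<rho> * a z))"
      proof (rule sum_norm_le)
        fix z assume z: "z \<in> Z"
        have "\<bar>g z x - \<eta> z x\<bar> * norm (A z (\<theta> u z)) \<le> \<delta> / (2 * \<rho> * s) * (\<rho> * a z)"
          using g(2)[OF x, of z] A_le[of "\<theta> u z" \<rho> z] cube[OF u z] \<delta> \<rho> s
          by (intro mult_mono) (auto simp: abs_minus_commute)
        then show "norm ((g z x - \<eta> z x) *\<^sub>R A z (\<theta> u z)) \<le> \<delta> / (2 * \<rho> * s) * (\<rho> * a z)" by simp
      qed
      also have "\<dots> = \<delta> / (2 * s) * (\<Sum>z\<in>Z. a z)"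
        using \<rho> by (simp add: sum_distrib_left)
      also have "\<dots> \<le> \<delta> / (2 * s) * s"
        using \<delta> s by (intro mult_left_mono) (auto simp: s_def)
      also have "\<dots> = \<delta> / 2" using s by simp
      finally have 1: "norm (\<Sum>z\<in>Z. (g z x - \<eta> z x) *\<^sub>R A z (\<theta> u z)) \<le> \<delta> / 2" .
      have 2: "norm (V0 x - V x) \<le> \<delta> / 2" using V0(2)[OF x] by (simp add: norm_minus_commute)
      have eq: "U u x - (V x + (\<Sum>z\<in>Z. \<eta> z x *\<^sub>R D (T / 2) z (\<theta> u z)))
          = (V0 x - V x) + (\<Sum>z\<in>Z. (g z x - \<eta> z x) *\<^sub>R A z (\<theta> u z))"
        by (simp add: U_def A_def scaleR_diff_left sum_subtractf)
      show ?thesis unfolding eq using norm_triangle_mono[OF 2 1] by simp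
    qed
    define Q where "Q u z = \<Phi> (- T) (\<Psi> u T z) - z" for u z
    have traj: "(\<forall>t\<in>{0..T}. \<Psi> u t z \<in> K) \<and> norm (Q u z - \<theta> u z) \<le> \<rho>" if u: "cube u" and z: "z \<in> Z" for u z
      unfolding Q_def
      by (rule main[OF z, of "\<theta> u" "U u" "\<lambda>t. \<Psi> u t z"]) (use cube[OF u] U_close[OF u] \<Psi>0 d\<Psi> in auto)
    obtain L0 where L0: "L0-lipschitz_on UNIV V0" using relu_class_lipschitz[OF V0(1)] .
    have "\<exists>L. L-lipschitz_on UNIV (g z)" for z using scalar_relu_lipschitz[OF g(1)] by metis
    then obtain Lg where Lg: "\<And>z. (Lg z)-lipschitz_on UNIV (g z)" by metis
    define L where "L = L0 + (\<Sum>z\<in>Z. Lg z * (\<rho> * a z))"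
    have L: "L \<ge> 0"
      using lipschitz_on_nonneg[OF L0] lipschitz_on_nonneg[OF Lg] \<rho> a0 by (simp add: L_def sum_nonneg)
    have U_lip: "norm (U u x - U u y) \<le> L * norm (x - y)" if u: "cube u" for u x y
    proof -
      have n1: "norm (\<Sum>z\<in>Z. (g z x - g z y) *\<^sub>R A z (\<theta> u z)) \<le> (\<Sum>z\<in>Z. Lg z * (\<rho> * a z) * norm (x - y))"
      proof (rule sum_norm_le)
        fix z assume z: "z \<in> Z"
        have "\<bar>g z x - g z y\<bar> * norm (A z (\<theta> u z)) \<le> (Lg z * norm (x - y)) * (\<rho> * a z)"
          using lipschitz_onD[OF Lg, of x y z] lipschitz_on_nonneg[OF Lg, of z] A_le[of "\<theta> u z" \<rho> z] cube[OF u z]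
          by (intro mult_mono) (auto simp: dist_norm)
        then show "norm ((g z x - g z y) *\<^sub>R A z (\<theta> u z)) \<le> Lg z * (\<rho> * a z) * norm (x - y)"
          by (simp add: mult_ac)
      qed
      have n2: "norm (V0 x - V0 y) \<le> L0 * norm (x - y)"
        using lipschitz_onD[OF L0, of x y] by (simp add: dist_norm)
      have eq: "U u x - U u y = (V0 x - V0 y) + (\<Sum>z\<in>Z. (g z x - g z y) *\<^sub>R A z (\<theta> u z))"
        by (simp add: U_def scaleR_diff_left sum_subtractf)
      have "norm (U u x - U u y) \<le> L0 * norm (x - y) + (\<Sum>z\<in>Z. Lg z * (\<rho> * a z) * norm (x - y))"
        unfolding eq by (rule norm_triangle_mono[OF n2 n1])
      then show ?thesis by (simp add: L_def distrib_right sum_distrib_right)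
    qed
    define H where "H x = (\<Sum>z\<in>Z. \<bar>g z x\<bar> * a z)" for x
    have "continuous_on K (g z)" for z
      by (rule continuous_on_subset[OF lipschitz_on_continuous_on[OF Lg] subset_UNIV])
    then have "continuous_on K H" unfolding H_def by (intro continuous_intros)
    then have "compact (H ` K)" using K by (rule compact_continuous_image)
    from compact_imp_bounded[OF this] obtain B where B: "B > 0" "\<forall>y\<in>H ` K. norm y \<le> B"
      unfolding bounded_pos by blast
    have U_param: "norm (U u x - U u' x) \<le> d * B" if x: "x \<in> K" and d: "\<forall>k\<in>I. \<bar>u k - u' k\<bar> \<le> d" "d \<ge> 0" for u u' x d
    proof -
      have "norm (\<Sum>z\<in>Z. g z x *\<^sub>R A z (\<theta> u z - \<theta> u' z)) \<le> (\<Sum>z\<in>Z. d * (\<bar>g z x\<bar> * a z))"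
      proof (rule sum_norm_le)
        fix z assume z: "z \<in> Z"
        have "norm (A z (\<theta> u z - \<theta> u' z)) \<le> d * a z"
          using d z by (intro A_le) (auto simp: inner_diff_left \<theta> I_def)
        then have "\<bar>g z x\<bar> * norm (A z (\<theta> u z - \<theta> u' z)) \<le> \<bar>g z x\<bar> * (d * a z)"
          by (rule mult_left_mono) simp
        then show "norm (g z x *\<^sub>R A z (\<theta> u z - \<theta> u' z)) \<le> d * (\<bar>g z x\<bar> * a z)"
          by (simp add: mult_ac)
      qed
      also have "\<dots> = d * H x" by (simp add: H_def sum_distrib_left)
      also have "\<dots> \<le> d * B" using B(2) x d(2) by (intro mult_left_mono) auto
      finally show ?thesis
        by (simp add: U_def linear_diff[OF linA] scaleR_diff_right sum_subtractf)
    qed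
    define E where "E = B * exp ((L + 1) * T)"
    have E: "E > 0" using B by (simp add: E_def)
    have \<Psi>_param: "norm (\<Psi> u T z - \<Psi> u' T z) \<le> d * E"
      if u: "cube u" "cube u'" and z: "z \<in> Z" and d: "\<forall>k\<in>I. \<bar>u k - u' k\<bar> \<le> d" "d \<ge> 0" for u u' z d
    proof -
      have "norm (\<Psi> u T z - \<Psi> u' T z) \<le> d * B * exp ((L + 1) * T)"
      proof (rule norm_le_exp_of_deriv_bound[where z' = "\<lambda>t. U u (\<Psi> u t z) - U u' (\<Psi> u' t z)" and T = T])
        show "((\<lambda>t. \<Psi> u t z - \<Psi> u' t z) has_vector_derivative U u (\<Psi> u t z) - U u' (\<Psi> u' t z)) (at t)" for t
          by (intro has_vector_derivative_diff d\<Psi>)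
        show "norm (U u (\<Psi> u t z) - U u' (\<Psi> u' t z)) \<le> L * norm (\<Psi> u t z - \<Psi> u' t z) + d * B"
          if "0 \<le> t" "t \<le> T" for t
        proof -
          \<comment> \<open>The difference is split at \<open>U u (\<Psi> u' t z)\<close>. A change
            of parameter is controlled on \<open>K\<close> only, so it is taken on the trajectory
            for \<open>u'\<close>, which stays in \<open>K\<close>; the change of point uses the
            global Lipschitz bound.\<close>
          have "\<Psi> u' t z \<in> K" using traj[OF u(2) z] that by auto
          from norm_triangle_mono[OF U_lip[OF u(1), of "\<Psi> u t z" "\<Psi> u' t z"] U_param[OF this d]]
          show ?thesis by simp
        qed
      qed (use \<Psi>0 L T B d in auto)
      then show ?thesis by (simp add: E_def mult.assoc)
    qed
    \<comment> \<open>Fixed points of \<open>G\<close> are the zeros of \<open>Q\<close>. On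
      \<open>I\<close> the entries of \<open>G u\<close> are the coordinates of
      \<open>\<theta> u z - Q u z\<close>, so the bound by \<rho> in \<open>traj\<close> is exactly
      what maps the cube to itself.\<close>
    define G where "G u k = u k - Q u (fst k) \<bullet> snd k" for u k
    have "\<exists>u. (\<forall>k\<in>I. \<bar>u k\<bar> \<le> \<rho>) \<and> (\<forall>k\<in>I. G u k = u k)"
    proof (rule fixpoint_cube[OF I \<rho>])
      fix u k assume "\<forall>k\<in>I. \<bar>u k\<bar> \<le> \<rho>" and k: "k \<in> I"
      then have u: "cube u" by (simp add: cube_def)
      obtain z e where ze: "k = (z, e)" "z \<in> Z" "e \<in> Basis" using k by (auto simp: I_def)
      have "\<bar>G u k\<bar> = \<bar>(Q u z - \<theta> u z) \<bullet> e\<bar>"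
        using ze by (simp add: G_def inner_diff_left \<theta> abs_minus_commute)
      also have "\<dots> \<le> norm (Q u z - \<theta> u z)" by (rule Basis_le_norm[OF ze(3)])
      also have "\<dots> \<le> \<rho>" using traj[OF u ze(2)] by simp
      finally show "\<bar>G u k\<bar> \<le> \<rho>" .
    next
      fix \<epsilon> :: real assume \<epsilon>: "\<epsilon> > 0"
      have "continuous_on K (\<lambda>x. \<Phi> (- T) x)" by (intro continuous_intros)
      then have unif: "uniformly_continuous_on K (\<lambda>x. \<Phi> (- T) x)"
        using K by (rule compact_uniformly_continuous)
      obtain \<delta>' where \<delta>': "\<delta>' > 0" "\<And>x y. \<lbrakk>x \<in> K; y \<in> K; dist y x < \<delta>'\<rbrakk> \<Longrightarrow> dist (\<Phi> (- T) y) (\<Phi> (- T) x) < \<epsilon> / 2"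
        using unif[unfolded uniformly_continuous_on_def, rule_format, OF half_gt_zero[OF \<epsilon>]] by blast
      \<comment> \<open>Half of \<epsilon> is for \<open>u\<close> itself and half for
        \<open>Q\<close>; the 1 yields the strict \<open>d * E < \<delta>'\<close> that uniform
        continuity needs.\<close>
      define d where "d = min (\<epsilon> / 2) (\<delta>' / (E + 1))"
      have "d > 0" using \<epsilon> \<delta>'(1) E by (simp add: d_def)
      moreover have "d \<le> \<epsilon> / 2" unfolding d_def by (rule min.cobounded1)
      ultimately have d: "d > 0" "d \<le> \<epsilon> / 2" .
      have "d * (E + 1) \<le> \<delta>' / (E + 1) * (E + 1)" using E by (intro mult_right_mono) (simp_all add: d_def)
      also have "\<dots> = \<delta>'" using E by simp
      finally have "d * E + d \<le> \<delta>'" by (simp add: distrib_left)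
      then have dE: "d * E < \<delta>'" using d(1) by linarith
      have "\<bar>G u k - G u' k\<bar> < \<epsilon>"
        if u: "\<forall>k\<in>I. \<bar>u k\<bar> \<le> \<rho>" "\<forall>k\<in>I. \<bar>u' k\<bar> \<le> \<rho>" "\<forall>k\<in>I. \<bar>u k - u' k\<bar> < d" and k: "k \<in> I" for u u' k
      proof -
        obtain z e where ze: "k = (z, e)" "z \<in> Z" "e \<in> Basis" using k by (auto simp: I_def)
        have c: "cube u" "cube u'" using u by (auto simp: cube_def)
        have "\<forall>k\<in>I. \<bar>u k - u' k\<bar> \<le> d" using u(3) by (auto intro: less_imp_le)
        then have "norm (\<Psi> u T z - \<Psi> u' T z) \<le> d * E"
          using d by (intro \<Psi>_param c ze) auto
        then have "dist (\<Phi> (- T) (\<Psi> u T z)) (\<Phi> (- T) (\<Psi> u' T z)) < \<epsilon> / 2"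
          using traj[OF c(1) ze(2)] traj[OF c(2) ze(2)] T dE by (intro \<delta>'(2)) (auto simp: dist_norm)
        then have "norm (Q u z - Q u' z) < \<epsilon> / 2" by (simp add: Q_def dist_norm)
        then have "\<bar>(Q u z - Q u' z) \<bullet> e\<bar> < \<epsilon> / 2"
          using Basis_le_norm[OF ze(3), of "Q u z - Q u' z"] by simp
        moreover have "\<bar>u k - u' k\<bar> < \<epsilon> / 2" using u(3) k d(2) by fastforce
        moreover have "G u k - G u' k = (u k - u' k) - (Q u z - Q u' z) \<bullet> e"
          by (simp add: G_def ze inner_diff_left)
        ultimately show ?thesis by linarith
      qed
      with d(1) show "\<exists>\<delta>>0. \<forall>x y. (\<forall>k\<in>I. \<bar>x k\<bar> \<le> \<rho>) \<longrightarrow> (\<forall>k\<in>I. \<bar>y k\<bar> \<le> \<rho>) \<longrightarrow>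
          (\<forall>k\<in>I. \<bar>x k - y k\<bar> < \<delta>) \<longrightarrow> (\<forall>k\<in>I. \<bar>G x k - G y k\<bar> < \<epsilon>)"
        by blast
    qed
    then obtain u where u: "\<And>k. k \<in> I \<Longrightarrow> G u k = u k" by blast
    show ?thesis
    proof (rule that[OF U_relu \<Psi>])
      fix z assume z: "z \<in> Z"
      have Qe: "Q u z \<bullet> e = 0" if "e \<in> Basis" for e
        using u[of "(z, e)"] z that by (simp add: G_def I_def)
      have "Q u z = 0" by (rule euclidean_eqI) (simp add: Qe)
      then have "\<Phi> (- T) (\<Psi> u T z) = z" by (simp add: Q_def)
      then show "\<Psi> u T z = \<Phi> T z" using flow_minus(2)[of T "\<Psi> u T z"] by simp
    qed
  qed
qed

theorem corollary2p5:
  fixes M :: nat and T :: real and x y :: "nat \<Rightarrow> real ^ 'n"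
  assumes "CARD('n) \<ge> 2" and "M \<ge> 1" and "admissible M x y" and "T > 0"
  shows "\<exists>(p::nat) (w :: nat \<Rightarrow> real ^ 'n) (a :: nat \<Rightarrow> real ^ 'n) (b :: nat \<Rightarrow> real) \<Phi>.
           global_flow (relu_field p w a b) \<Phi> \<and> (\<forall>i\<in>{1..M}. \<Phi> T (x i) = y i)"
proof -
  have dim: "DIM(real ^ 'n) \<ge> 2" using assms(1) by simp
  have inj: "inj_on x {1..M}" "inj_on y {1..M}" using assms(3) by (auto simp: admissible_def)
  obtain Z \<sigma> where Z: "finite Z" "\<sigma> permutes Z" "x ` {1..M} \<subseteq> Z" and \<sigma>: "\<And>i. i \<in> {1..M} \<Longrightarrow> \<sigma> (x i) = y i"
    by (rule extend_to_permutation[OF finite_atLeastAtMost inj]) (rule that)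
  \<comment> \<open>\<open>M \<ge> 1\<close> makes \<open>Z\<close> nonempty, so
    \<open>card Z\<close> can stand in the denominator of the constants.\<close>
  have "x 1 \<in> Z" using Z(3) assms(2) by auto
  then have "Z \<noteq> {}" by blast
  obtain \<Phi> V D where flow: "c1_flow \<Phi> V D" and \<Phi>: "\<And>z. z \<in> Z \<Longrightarrow> \<Phi> T z = \<sigma> z"
    and sep: "\<And>z z' t. \<lbrakk>z \<in> Z; z' \<in> Z; 0 \<le> t; t \<le> T; \<Phi> t z' = \<Phi> (T / 2) z\<rbrakk> \<Longrightarrow> z' = z \<and> t = T / 2"
    by (rule permutation_flow[OF dim Z(1,2) assms(4)]) (rule that)
  obtain W \<Psi> where W: "W \<in> relu_class" "global_flow W \<Psi>" and \<Psi>: "\<And>z. z \<in> Z \<Longrightarrow> \<Psi> T z = \<Phi> T z"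
    by (rule relu_flow_interpolation[OF flow Z(1) \<open>Z \<noteq> {}\<close> assms(4)]) (erule (4) sep, rule that)
  obtain p w a b where "W = relu_field p w a b" using W(1) unfolding relu_class_def by blast
  moreover have "\<Psi> T (x i) = y i" if "i \<in> {1..M}" for i
    using \<Psi> \<Phi> \<sigma> Z(3) that by (metis image_subset_iff)
  ultimately show ?thesis using W(2) by blast
qed

end
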